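(* There is a polynomial-time algorithm that, given a finite undirected graph $G$, computes the number of homogeneous pairs in $G$.
   Context: Graphs are simple (no loops). A homogeneous pair in a graph $G=(V,E)$ is a partition of $V$ into (pairwise disjoint, labelled, with $W_1$ or $W_2$ possibly empty) sets $U$, $W_1$ and $W_2$ such that: $|U|\geq 2$; $|W_1|\geq 2$ or $|W_2|\geq 2$ (or both); for every vertex $v\in U$, $v$ is either adjacent to every vertex in $W_1$ or to none of them; and for every vertex $v\in U$, $v$ is either adjacent to every vertex in $W_2$ or to none of them. Homogeneous pairs are counted as ordered triples $(U,W_1,W_2)$. *)

theory Defs
  imports
    "HOL-Library.Log_Nat"
    "HOL-Computational_Algebra.Polynomial"
    "Graph_Theory.Pair_Digraph"
begin

section \<open>Homogeneous pairs\<close>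

text \<open>A finite simple undirected graph is a \<^const>\<open>pair_graph\<close>: a finite, symmetric, loop-free
  set of arcs on a finite vertex set.\<close>

definition all_or_none_adjacent :: "'a pair_pre_digraph \<Rightarrow> 'a \<Rightarrow> 'a set \<Rightarrow> bool" where
  "all_or_none_adjacent G v W \<longleftrightarrow>
     (\<forall>w\<in>W. (v, w) \<in> parcs G) \<or> (\<forall>w\<in>W. (v, w) \<notin> parcs G)"

definition homogeneous_pair ::
    "'a pair_pre_digraph \<Rightarrow> 'a set \<Rightarrow> 'a set \<Rightarrow> 'a set \<Rightarrow> bool" where
  "homogeneous_pair G U W1 W2 \<longleftrightarrow>
     U \<union> W1 \<union> W2 = pverts G \<and> U \<inter> W1 = {} \<and> U \<inter> W2 = {} \<and> W1 \<inter> W2 = {} \<and>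
     card U \<ge> 2 \<and> (card W1 \<ge> 2 \<or> card W2 \<ge> 2) \<and>
     (\<forall>v\<in>U. all_or_none_adjacent G v W1) \<and>
     (\<forall>v\<in>U. all_or_none_adjacent G v W2)"

definition homogeneous_pairs :: "'a pair_pre_digraph \<Rightarrow> ('a set \<times> 'a set \<times> 'a set) set" where
  "homogeneous_pairs G = {(U, W1, W2). homogeneous_pair G U W1 W2}"


section \<open>Random access machines with logarithmic cost\<close>

text \<open>
  The machine model is the random access machine under the logarithmic cost criterion
  (Aho, Hopcroft and Ullman, The Design and Analysis of Computer Algorithms, Chapter 1), in a
  three-address version. It is polynomially equivalent to the multitape Turing machine. Registers
  hold natural numbers, \<open>SUB\<close> is truncated subtraction, \<open>LOAD\<close> and \<open>STORE\<close> are the indirect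
  accesses, and the machine halts when the program counter leaves the program.
\<close>

datatype instr =
    SETC nat nat       \<comment> \<open>\<open>SETC i c\<close>: \<open>R\<^sub>i := c\<close>\<close>
  | COPY nat nat       \<comment> \<open>\<open>COPY i j\<close>: \<open>R\<^sub>i := R\<^sub>j\<close>\<close>
  | ADD nat nat nat    \<comment> \<open>\<open>ADD i j k\<close>: \<open>R\<^sub>i := R\<^sub>j + R\<^sub>k\<close>\<close>
  | SUB nat nat nat    \<comment> \<open>\<open>SUB i j k\<close>: \<open>R\<^sub>i := R\<^sub>j - R\<^sub>k\<close>\<close>
  | LOAD nat nat       \<comment> \<open>\<open>LOAD i j\<close>: \<open>R\<^sub>i := R[R\<^sub>j]\<close>\<close>
  | STORE nat nat      \<comment> \<open>\<open>STORE i j\<close>: \<open>R[R\<^sub>i] := R\<^sub>j\<close>\<close>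
  | JUMP nat           \<comment> \<open>\<open>JUMP l\<close>: go to \<open>l\<close>\<close>
  | JZERO nat nat      \<comment> \<open>\<open>JZERO i l\<close>: go to \<open>l\<close> if \<open>R\<^sub>i = 0\<close>\<close>

type_synonym program = "instr list"
type_synonym store = "nat \<Rightarrow> nat"

fun exec :: "instr \<Rightarrow> nat \<times> store \<Rightarrow> nat \<times> store" where
  "exec (SETC i c) (pc, R) = (Suc pc, R(i := c))"
| "exec (COPY i j) (pc, R) = (Suc pc, R(i := R j))"
| "exec (ADD i j k) (pc, R) = (Suc pc, R(i := R j + R k))"
| "exec (SUB i j k) (pc, R) = (Suc pc, R(i := R j - R k))"
| "exec (LOAD i j) (pc, R) = (Suc pc, R(i := R (R j)))"
| "exec (STORE i j) (pc, R) = (Suc pc, R(R i := R j))"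
| "exec (JUMP l) (pc, R) = (l, R)"
| "exec (JZERO i l) (pc, R) = (if R i = 0 then l else Suc pc, R)"

text \<open>The number of binary digits of \<open>n\<close>, where \<open>0\<close> has one digit.\<close>

definition len :: "nat \<Rightarrow> nat" where
  "len n = max 1 (floorlog 2 n)"

text \<open>The cost of an instruction is the total length of all addresses and operands involved.\<close>

fun cost :: "instr \<Rightarrow> store \<Rightarrow> nat" where
  "cost (SETC i c) R = len i + len c"
| "cost (COPY i j) R = len i + len j + len (R j)"
| "cost (ADD i j k) R = len i + len j + len (R j) + len k + len (R k)"
| "cost (SUB i j k) R = len i + len j + len (R j) + len k + len (R k)"
| "cost (LOAD i j) R = len i + len j + len (R j) + len (R (R j))"
| "cost (STORE i j) R = len i + len (R i) + len j + len (R j)"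
| "cost (JUMP l) R = 1"
| "cost (JZERO i l) R = len i + len (R i)"

text \<open>\<open>halts_with P c t R\<close>: started in configuration \<open>c\<close>, program \<open>P\<close> halts after total cost \<open>t\<close>
  with final store \<open>R\<close>.\<close>

inductive halts_with :: "program \<Rightarrow> nat \<times> store \<Rightarrow> nat \<Rightarrow> store \<Rightarrow> bool" for P where
  halt: "length P \<le> pc \<Longrightarrow> halts_with P (pc, R) 0 R"
| step: "pc < length P \<Longrightarrow> halts_with P (exec (P ! pc) (pc, R)) t R' \<Longrightarrow>
           halts_with P (pc, R) (cost (P ! pc) R + t) R'"

lemma halts_with_deterministic:
  "halts_with P c t R \<Longrightarrow> halts_with P c t' R' \<Longrightarrow> t' = t \<and> R' = R"
proof (induction arbitrary: t' R' rule: halts_with.induct)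
  case (halt pc R)
  from halt.prems show ?case
  proof cases
    case halt
    then show ?thesis by simp
  next
    case step
    with halt.hyps show ?thesis by linarith
  qed
next
  case (step pc R t R'')
  from step.prems show ?case
  proof cases
    case halt
    with step.hyps show ?thesis by linarith
  next
    case (step u)
    from step(3) have "u = t \<and> R' = R''" by (rule step.IH)
    with step(1) show ?thesis by simp
  qed
qed

text \<open>The input word is preceded by its length, which is stored in register \<open>0\<close>; all registers
  beyond the input are \<open>0\<close>. The output is the content of register \<open>0\<close>.\<close>

definition input_store :: "bool list \<Rightarrow> store" where
  "input_store w a =
     (if a = 0 then length w else if a \<le> length w then of_bool (w ! (a - 1)) else 0)"

definition computes_in_poly_time ::
    "program \<Rightarrow> 'i set \<Rightarrow> ('i \<Rightarrow> bool list) \<Rightarrow> ('i \<Rightarrow> nat) \<Rightarrow> bool" where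
  "computes_in_poly_time P X encode f \<longleftrightarrow>
     (\<exists>p :: nat poly. \<forall>x\<in>X. \<exists>t R.
        halts_with P (0, input_store (encode x)) t R \<and>
        R 0 = f x \<and> t \<le> poly p (length (encode x)))"

definition poly_time_computable :: "'i set \<Rightarrow> ('i \<Rightarrow> bool list) \<Rightarrow> ('i \<Rightarrow> nat) \<Rightarrow> bool" where
  "poly_time_computable X encode f \<longleftrightarrow> (\<exists>P. computes_in_poly_time P X encode f)"

text \<open>Graphs are given by their adjacency matrix, row by row, with the vertices in increasing
  order. The entries do not depend on the names of the vertices, only on their order.\<close>

definition adjacency_word :: "'a::linorder pair_pre_digraph \<Rightarrow> bool list" where
  "adjacency_word G =
     (let vs = sorted_list_of_set (pverts G) in [(u, v) \<in> parcs G. u \<leftarrow> vs, v \<leftarrow> vs])"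

end

theory Submission
  imports Defs
begin

text \<open>
  Fix the least elements \<open>a\<close> of \<open>W\<^sub>1\<close> and \<open>c\<close> of \<open>W\<^sub>2\<close>. They determine how a vertex \<open>y\<close> of \<open>U\<close> sees the
  two parts, so homogeneity says that \<open>C = W\<^sub>1 \<union> W\<^sub>2\<close> is closed under certain implications
  \<open>x \<in> C \<longrightarrow> y \<in> C\<close>. If some vertex of \<open>U\<close> distinguishes \<open>a\<close> from \<open>c\<close>, then the least such vertex fixes
  the part to which an element of \<open>C\<close> can belong; otherwise the part does not matter for the
  implications, and \<open>C\<close> is counted with the number of its splittings as weight. The cardinality
  conditions are handled by fixing a few more least elements.

  Counting closed sets of a digraph is hard in general. Here the vertices fall into eight classes,
  given by the part and by the adjacency to \<open>a\<close> and to \<open>c\<close>, and for any two classes either all implications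
  between them are equivalences or any two of their vertices are comparable. After two suitable maximal
  elements of \<open>C\<close> have been fixed, all implications between undecided vertices are equivalences, so
  that the weight is a product over connected components.

  The resulting expression consists of additions, subtractions and loops over the vertices, and a
  random access machine evaluates such expressions in polynomial time: a step lengthens the
  operands by at most one digit.
\<close>

section \<open>Structured programs\<close>

text \<open>Why two maximal elements suffice: the two possible arcs between \<open>x\<close> and
  \<open>y\<close> compare the same bit \<open>adj x y\<close> with two targets that depend only on
  the classes. Equal targets give both arcs or none, different targets exactly one. Join two
  distinct classes if their targets are equal. This graph on the eight classes has no triangle.
  Maximality of the first element leaves undecided only vertices of its own class and of the classes
  joined to it. The latter are not joined to each other, so a second element is needed, and it
  leaves just one of them. The expression also has to be evaluated without multiplication. Every
  factor is \<open>0\<close>, \<open>1\<close>, \<open>2\<close> or one more than a product of such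
  numbers, so it can be applied to a running product by additions. The values may be exponential,
  but only their digits are charged.\<close>

inductive halts_in :: "program \<Rightarrow> nat \<times> store \<Rightarrow> nat \<Rightarrow> store \<Rightarrow> bool" for P where
  halt: "length P \<le> pc \<Longrightarrow> halts_in P (pc, R) 0 R"
| step: "pc < length P \<Longrightarrow> halts_in P (exec (P ! pc) (pc, R)) k R' \<Longrightarrow>
           halts_in P (pc, R) (Suc k) R'"

text \<open>These are the numbers in an instruction whose length \<open>cost\<close> charges; jump
  targets are free and therefore missing.\<close>

fun operands :: "instr \<Rightarrow> nat set" where
  "operands (SETC i c) = {i, c}"
| "operands (COPY i j) = {i, j}"
| "operands (ADD i j k) = {i, j, k}"
| "operands (SUB i j k) = {i, j, k}"
| "operands (LOAD i j) = {i, j}"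
| "operands (STORE i j) = {i, j}"
| "operands (JUMP l) = {}"
| "operands (JZERO i l) = {i}"

lemma len_le:
  assumes "x < 2 ^ b" "0 < b"
  shows "len x \<le> b"
  using assms by (simp add: len_def floorlog_le_iff)

text \<open>The factor \<open>5\<close> comes from \<open>ADD\<close> and \<open>SUB\<close>, which
  are charged for three addresses and two operands.\<close>

lemma cost_le:
  assumes "\<And>a. R a < 2 ^ b" "\<And>a. a \<in> operands i \<Longrightarrow> a < 2 ^ b" "0 < b"
  shows "cost i R \<le> 5 * b"
proof -
  have R: "len (R a) \<le> b" for a
    using assms by (simp add: len_le)
  have o: "len a \<le> b" if "a \<in> operands i" for a
    using that assms by (simp add: len_le)
  show ?thesis
  proof (cases i)
    case (SETC x c)
    then show ?thesis using o[of x] o[of c] by simp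
  next
    case (COPY x j)
    then show ?thesis using o[of x] o[of j] R[of j] by simp
  next
    case (ADD x j k)
    then show ?thesis using o[of x] o[of j] o[of k] R[of j] R[of k] by simp
  next
    case (SUB x j k)
    then show ?thesis using o[of x] o[of j] o[of k] R[of j] R[of k] by simp
  next
    case (LOAD x j)
    then show ?thesis using o[of x] o[of j] R[of j] R[of "R j"] by simp
  next
    case (STORE x j)
    then show ?thesis using o[of x] o[of j] R[of j] R[of x] by simp
  next
    case (JUMP l)
    then show ?thesis using assms by simp
  next
    case (JZERO x l)
    then show ?thesis using o[of x] R[of x] by simp
  qed
qed

lemma exec_bound:
  assumes "\<And>a. R a < 2 ^ b" "\<And>a. a \<in> operands i \<Longrightarrow> a < 2 ^ b"
  shows "snd (exec i (pc, R)) a < 2 ^ Suc b"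
proof -
  have R: "R a < 2 ^ b" for a by fact
  have "R a < 2 * 2 ^ b" "R a - x < 2 * 2 ^ b" "R a + R a' < 2 * 2 ^ b" for a a' x
    using R[of a] R[of a'] by linarith+
  moreover have "a < 2 * 2 ^ b" if "a \<in> operands i" for a
    using assms(2)[OF that] by linarith
  ultimately show ?thesis
    by (cases i) auto
qed

text \<open>Addition is the strongest arithmetic instruction, so a step lengthens the operands by at most
  one digit and the number of steps controls the logarithmic cost.\<close>

lemma halts_in_cost:
  assumes "halts_in P (pc, R) k R'"
    and "\<And>a. R a < 2 ^ b" "\<And>a. a \<in> \<Union> (operands ` set P) \<Longrightarrow> a < 2 ^ b" "0 < b"
  shows "\<exists>t. halts_with P (pc, R) t R' \<and> t \<le> k * (5 * (b + k))"
  using assms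
proof (induction "(pc, R)" k R' arbitrary: pc R b rule: halts_in.induct)
  case (halt pc R)
  then show ?case using halts_with.halt by fastforce
next
  case (step pc R k R')
  obtain pc' R1 where ex: "exec (P ! pc) (pc, R) = (pc', R1)" by fastforce
  have in_P: "P ! pc \<in> set P" using step by simp
  have R1: "R1 a < 2 ^ Suc b" for a
    using exec_bound[of R b "P ! pc" pc a] step.prems in_P ex by auto
  have ops: "a < 2 ^ Suc b" if "a \<in> \<Union> (operands ` set P)" for a
    using step.prems(2)[OF that] by simp
  \<comment> \<open>The digit that this step may add is balanced by the step that is used up:
    \<open>Suc b + k = b + Suc k\<close>.\<close>
  obtain t where t: "halts_with P (pc', R1) t R'" "t \<le> k * (5 * (Suc b + k))"
    using step(3)[OF ex R1 ops zero_less_Suc] by blast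
  have "cost (P ! pc) R \<le> 5 * b"
    by (rule cost_le) (use step.prems in_P in auto)
  with t(2) have "cost (P ! pc) R + t \<le> Suc k * (5 * (b + Suc k))"
    by (simp add: algebra_simps)
  moreover have "halts_with P (pc, R) (cost (P ! pc) R + t) R'"
    by (rule halts_with.step) (use step(1) t(1) ex in simp_all)
  ultimately show ?case by blast
qed

section \<open>A language with loops and its translation into jumps\<close>

datatype cmd = Prim instr | Seq cmd cmd (infixr ";;" 60) | While nat cmd

fun code_size :: "cmd \<Rightarrow> nat" where
  "code_size (Prim i) = 1"
| "code_size (c ;; d) = code_size c + code_size d"
| "code_size (While r c) = code_size c + 2"

fun code :: "nat \<Rightarrow> cmd \<Rightarrow> program" where
  "code l (Prim i) = [i]"
| "code l (c ;; d) = code l c @ code (l + code_size c) d"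
| "code l (While r c) = JZERO r (l + code_size c + 2) # code (Suc l) c @ [JUMP l]"

lemma length_code [simp]: "length (code l c) = code_size c"
  by (induction c arbitrary: l) auto

fun jump_free :: "instr \<Rightarrow> bool" where
  "jump_free (JUMP l) = False"
| "jump_free (JZERO i l) = False"
| "jump_free _ = True"

text \<open>Times are exact step counts of the compiled code: the final test of a loop costs one
  \<open>JZERO\<close>, every round a \<open>JZERO\<close> and a \<open>JUMP\<close>.\<close>

inductive big_step :: "cmd \<Rightarrow> store \<Rightarrow> nat \<Rightarrow> store \<Rightarrow> bool" where
  Prim: "jump_free i \<Longrightarrow> big_step (Prim i) R 1 (snd (exec i (0, R)))"
| Seq: "big_step c R s R1 \<Longrightarrow> big_step d R1 t R2 \<Longrightarrow> big_step (c ;; d) R (s + t) R2"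
| While_0: "R r = 0 \<Longrightarrow> big_step (While r c) R 1 R"
| While_Suc: "R r \<noteq> 0 \<Longrightarrow> big_step c R s R1 \<Longrightarrow> big_step (While r c) R1 t R2 \<Longrightarrow>
    big_step (While r c) R (s + t + 2) R2"

lemma exec_jump_free:
  assumes "jump_free i"
  shows "exec i (pc, R) = (Suc pc, snd (exec i (0, R)))"
  using assms by (cases i) auto

text \<open>Jump targets are absolute, so the code is considered at its place inside a larger
  program. The arbitrary continuation after it lets sequences and loop rounds be chained from the
  end backwards.\<close>

lemma halts_in_code:
  assumes "big_step c R t R'" "P = xs @ code (length xs) c @ ys"
    "halts_in P (length xs + code_size c, R') k R''"
  shows "halts_in P (length xs, R) (t + k) R''"
  using assms
proof (induction arbitrary: xs ys k R'' rule: big_step.induct)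
  case (Prim i R)
  have "P ! length xs = i" using Prim.prems by simp
  then show ?case
    using Prim halts_in.step[of "length xs" P R k R''] exec_jump_free[of i "length xs" R] by simp
next
  case (Seq c R s R1 d t R2)
  let ?xs = "xs @ code (length xs) c"
  have "halts_in P (length ?xs, R1) (t + k) R''"
    by (rule Seq.IH(2)[of _ ys]) (use Seq.prems in \<open>simp_all add: add.assoc\<close>)
  then have "halts_in P (length xs, R) (s + (t + k)) R''"
    by (intro Seq.IH(1)[of _ "code (length xs + code_size c) d @ ys"]) (use Seq.prems in simp_all)
  then show ?case by (simp add: add.assoc)
next
  case (While_0 R r c)
  have "P ! length xs = JZERO r (length xs + code_size c + 2)" using While_0.prems by simp
  then show ?case
    using While_0 halts_in.step[of "length xs" P R k R''] by (simp add: add.assoc)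
next
  case (While_Suc R r c s R1 t R2)
  let ?xs = "xs @ [JZERO r (length xs + code_size c + 2)]"
  have jz: "P ! length xs = JZERO r (length xs + code_size c + 2)"
    using While_Suc.prems by simp
  have "P = (?xs @ code (Suc (length xs)) c) @ JUMP (length xs) # ys"
    using While_Suc.prems by simp
  moreover have "length (?xs @ code (Suc (length xs)) c) = length ?xs + code_size c"
    by simp
  ultimately have jump: "P ! (length ?xs + code_size c) = JUMP (length xs)"
    "length ?xs + code_size c < length P"
    by (metis nth_append_length, simp)
  have "halts_in P (length xs, R1) (t + k) R''"
    by (rule While_Suc.IH(2)) (use While_Suc.prems in simp_all)
  then have "halts_in P (length ?xs + code_size c, R1) (Suc (t + k)) R''"
    using jump by (intro halts_in.step) auto
  then have "halts_in P (length ?xs, R) (s + Suc (t + k)) R''"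
    by (intro While_Suc.IH(1)[of _ "JUMP (length xs) # ys"]) (use While_Suc.prems in simp_all)
  then have "halts_in P (length xs, R) (Suc (s + Suc (t + k))) R''"
    using jz While_Suc by (intro halts_in.step) auto
  then show ?case by (simp add: add.assoc)
qed

corollary halts_in_big_step:
  assumes "big_step c R t R'"
  shows "halts_in (code 0 c) (0, R) t R'"
  using halts_in_code[OF assms, of "code 0 c" "[]" "[]" 0 R'] by (simp add: halts_in.halt)

section \<open>Functions computable with bounded loops\<close>

text \<open>Register \<open>0\<close> points to a read-only memory \<open>m\<close>, which starts beyond the first \<open>K\<close> registers and
  extends to infinity. Later \<open>m\<close> is an \<open>n \<times> n\<close> matrix.\<close>

definition memory_ok :: "nat \<Rightarrow> nat \<Rightarrow> (nat \<Rightarrow> nat) \<Rightarrow> store \<Rightarrow> bool" where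
  "memory_ok K n m R \<longleftrightarrow> K \<le> R 0 \<and> R 1 = n \<and> R 2 = 1 \<and> (\<forall>k. R (R 0 + k) = m k)"

definition preserves :: "nat \<Rightarrow> store \<Rightarrow> store \<Rightarrow> bool" where
  "preserves d R R' \<longleftrightarrow> (\<forall>r. r < d \<or> R 0 \<le> r \<longrightarrow> R' r = R r)"

lemma memory_ok_mono: "memory_ok K n m R \<Longrightarrow> K' \<le> K \<Longrightarrow> memory_ok K' n m R"
  by (simp add: memory_ok_def)

lemma memory_ok_preserves:
  "memory_ok K n m R \<Longrightarrow> preserves d R R' \<Longrightarrow> 3 \<le> d \<Longrightarrow> memory_ok K n m R'"
  by (simp add: memory_ok_def preserves_def)

lemma preserves_trans:
  "preserves d R R1 \<Longrightarrow> preserves d' R1 R2 \<Longrightarrow> 3 \<le> d \<Longrightarrow> d \<le> d' \<Longrightarrow> preserves d R R2"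
  by (simp add: preserves_def)

lemma preserves_upd:
  "d \<le> i \<Longrightarrow> i < R 0 \<Longrightarrow> 3 \<le> d \<Longrightarrow> preserves d R (R(i := x))"
  by (auto simp add: preserves_def)

type_synonym 'e fn = "nat \<times> (nat \<Rightarrow> nat) \<Rightarrow> 'e \<Rightarrow> nat"

definition holds :: "nat list \<Rightarrow> 'e fn list \<Rightarrow> nat \<times> (nat \<Rightarrow> nat) \<Rightarrow> 'e \<Rightarrow> store \<Rightarrow> bool" where
  "holds rs \<Gamma> g e R \<longleftrightarrow> list_all2 (\<lambda>r h. R r = h g e) rs \<Gamma>"

lemma holds_preserves:
  assumes "holds rs \<Gamma> g e R" "preserves d R R'" "\<forall>r\<in>set rs. r < d"
  shows "holds rs \<Gamma> g e R'"
  using assms(1) unfolding holds_def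
  by (rule list.rel_mono_strong) (use assms in \<open>auto simp: preserves_def\<close>)

text \<open>The values of the functions \<open>\<Gamma>\<close> are available in the registers \<open>rs\<close>; the program leaves the
  registers below its target \<open>d\<close> and the memory untouched and uses those from \<open>d\<close> on as scratch space.
  As every loop runs at most \<open>n\<close> times, only the number of steps has to be bounded; the numbers may
  have a polynomial number of digits.\<close>

definition computes ::
    "nat list \<Rightarrow> 'e fn list \<Rightarrow> nat \<Rightarrow> 'e fn \<Rightarrow> cmd \<Rightarrow> nat \<Rightarrow> nat poly \<Rightarrow> bool" where
  "computes rs \<Gamma> d f c K q \<longleftrightarrow>
     (\<forall>n m e R. memory_ok K n m R \<longrightarrow> holds rs \<Gamma> (n, m) e R \<longrightarrow>
        (\<exists>t R'. big_step c R t R' \<and> t \<le> poly q n \<and> R' d = f (n, m) e \<and> preserves d R R'))"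

text \<open>The program is chosen after the registers \<open>rs\<close> and the target
  \<open>d\<close>, so a subprogram can be compiled for whatever registers its context has left
  free.\<close>

definition efficient :: "'e fn list \<Rightarrow> 'e fn \<Rightarrow> bool" where
  "efficient \<Gamma> f \<longleftrightarrow> (\<forall>rs d. (\<forall>r\<in>set rs. r < d) \<longrightarrow> 3 \<le> d \<longrightarrow> (\<exists>c K q. computes rs \<Gamma> d f c K q))"

lemma efficientE:
  assumes "efficient \<Gamma> f" "\<forall>r\<in>set rs. r < d" "3 \<le> d"
  obtains c K q where "computes rs \<Gamma> d f c K q"
  using assms unfolding efficient_def by blast

lemma computesE:
  assumes "computes rs \<Gamma> d f c K q" "memory_ok K' n m R" "K \<le> K'" "holds rs \<Gamma> (n, m) e R"
  obtains t R' where "big_step c R t R'" "t \<le> poly q n" "R' d = f (n, m) e" "preserves d R R'"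
  using assms memory_ok_mono unfolding computes_def by blast

lemma big_step_PrimI:
  "jump_free i \<Longrightarrow> snd (exec i (0, R)) = R' \<Longrightarrow> big_step (Prim i) R 1 R'"
  using big_step.Prim by blast

section \<open>Closure properties of efficient functions\<close>

lemma efficient_instr:
  assumes i: "\<And>rs d. \<forall>r\<in>set rs. r < d \<Longrightarrow> 3 \<le> d \<Longrightarrow>
     \<exists>i. jump_free i \<and> (\<forall>n m e R. memory_ok (Suc d) n m R \<longrightarrow> holds rs \<Gamma> (n, m) e R \<longrightarrow>
       snd (exec i (0, R)) = R(d := f (n, m) e))"
  shows "efficient \<Gamma> f"
  unfolding efficient_def
proof (intro allI impI)
  fix rs d assume d: "\<forall>r\<in>set rs. r < d" "(3 :: nat) \<le> d"
  then obtain i where i: "jump_free i"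
    "\<And>n m e R. memory_ok (Suc d) n m R \<Longrightarrow> holds rs \<Gamma> (n, m) e R \<Longrightarrow>
       snd (exec i (0, R)) = R(d := f (n, m) e)"
    using assms[OF d] by blast
  have "computes rs \<Gamma> d f (Prim i) (Suc d) [:1:]"
    unfolding computes_def
  proof (intro allI impI)
    fix n m e R assume R: "memory_ok (Suc d) n m R" "holds rs \<Gamma> (n, m) e R"
    have "big_step (Prim i) R 1 (R(d := f (n, m) e))"
      using big_step.Prim[OF i(1), of R] i(2)[OF R] by simp
    moreover have "preserves d R (R(d := f (n, m) e))"
      by (rule preserves_upd) (use d R(1) in \<open>auto simp: memory_ok_def\<close>)
    ultimately show "\<exists>t R'. big_step (Prim i) R t R' \<and> t \<le> poly [:1:] n \<and>
        R' d = f (n, m) e \<and> preserves d R R'"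
      by (intro exI[of _ 1] exI[of _ "R(d := f (n, m) e)"]) simp
  qed
  then show "\<exists>c K q. computes rs \<Gamma> d f c K q" by blast
qed

lemma efficient_const: "efficient \<Gamma> (\<lambda>g e. k)"
  by (rule efficient_instr, rule exI[of _ "SETC _ k"]) auto

lemma efficient_size: "efficient \<Gamma> (\<lambda>g e. fst g)"
  by (rule efficient_instr, rule exI[of _ "COPY _ 1"]) (auto simp: memory_ok_def)

lemma efficient_var:
  assumes "h \<in> set \<Gamma>"
  shows "efficient \<Gamma> h"
proof (rule efficient_instr)
  fix rs :: "nat list" and d :: nat
  obtain k where k: "k < length \<Gamma>" "\<Gamma> ! k = h" using assms by (auto simp: in_set_conv_nth)
  show "\<exists>i. jump_free i \<and> (\<forall>n m e R. memory_ok (Suc d) n m R \<longrightarrow> holds rs \<Gamma> (n, m) e R \<longrightarrow>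
       snd (exec i (0, R)) = R(d := h (n, m) e))"
    by (rule exI[of _ "COPY d (rs ! k)"]) (use k in \<open>auto simp: holds_def list_all2_conv_all_nth\<close>)
qed

text \<open>The second program has target \<open>Suc d\<close> and so leaves the first value in
  register \<open>d\<close> intact.\<close>

lemma efficient_instr2:
  assumes f: "efficient \<Gamma> f" and g: "efficient \<Gamma> g"
    and i: "\<And>d. jump_free (i d)" "\<And>d R. snd (exec (i d) (0, R)) = R(d := h (R d) (R (Suc d)))"
  shows "efficient \<Gamma> (\<lambda>x e. h (f x e) (g x e))"
  unfolding efficient_def
proof (intro allI impI)
  fix rs d assume d: "\<forall>r\<in>set rs. r < d" "(3 :: nat) \<le> d"
  from f d obtain c K q where c: "computes rs \<Gamma> d f c K q" by (rule efficientE)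
  have d': "\<forall>r\<in>set rs. r < Suc d" "3 \<le> Suc d" using d by auto
  from g d' obtain c' K' q' where c': "computes rs \<Gamma> (Suc d) g c' K' q'" by (rule efficientE)
  let ?c = "c ;; c' ;; Prim (i d)" and ?K = "max (Suc d) (max K K')" and ?q = "q + q' + 1"
  have "computes rs \<Gamma> d (\<lambda>x e. h (f x e) (g x e)) ?c ?K ?q"
    unfolding computes_def
  proof (intro allI impI)
    fix n m e R assume R: "memory_ok ?K n m R" "holds rs \<Gamma> (n, m) e R"
    obtain t R1 where 1: "big_step c R t R1" "t \<le> poly q n" "R1 d = f (n, m) e" "preserves d R R1"
      by (rule computesE[OF c R(1) _ R(2)]) auto
    have R1: "memory_ok ?K n m R1" "holds rs \<Gamma> (n, m) e R1"
      using memory_ok_preserves[OF R(1) 1(4) d(2)] holds_preserves[OF R(2) 1(4) d(1)] by auto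
    obtain t' R2 where 2: "big_step c' R1 t' R2" "t' \<le> poly q' n" "R2 (Suc d) = g (n, m) e"
      "preserves (Suc d) R1 R2"
      by (rule computesE[OF c' R1(1) _ R1(2)]) auto
    have R2: "memory_ok ?K n m R2" by (rule memory_ok_preserves[OF R1(1) 2(4) d'(2)])
    let ?R = "snd (exec (i d) (0, R2))"
    have "big_step ?c R (t + (t' + 1)) ?R"
      by (rule Seq[OF 1(1) Seq[OF 2(1) big_step_PrimI[OF i(1) refl]]])
    moreover have "preserves d R ?R"
    proof -
      have "preserves d R2 ?R"
        unfolding i by (rule preserves_upd) (use R2 d in \<open>auto simp: memory_ok_def\<close>)
      then show ?thesis
        using 1(4) 2(4) d by (blast intro: preserves_trans le_SucI order_refl)
    qed
    moreover have "?R d = h (f (n, m) e) (g (n, m) e)"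
      using 1(3) 2(3,4) i by (simp add: preserves_def)
    ultimately show "\<exists>t R'. big_step ?c R t R' \<and> t \<le> poly ?q n \<and>
        R' d = h (f (n, m) e) (g (n, m) e) \<and> preserves d R R'"
      using 1(2) 2(2) by (intro exI[of _ "t + (t' + 1)"] exI[of _ ?R]) simp
  qed
  then show "\<exists>c K q. computes rs \<Gamma> d (\<lambda>x e. h (f x e) (g x e)) c K q" by blast
qed

lemma efficient_add: "efficient \<Gamma> f \<Longrightarrow> efficient \<Gamma> g \<Longrightarrow> efficient \<Gamma> (\<lambda>x e. f x e + g x e)"
  by (rule efficient_instr2[where i = "\<lambda>d. ADD d d (Suc d)"]) auto

lemma efficient_diff: "efficient \<Gamma> f \<Longrightarrow> efficient \<Gamma> g \<Longrightarrow> efficient \<Gamma> (\<lambda>x e. f x e - g x e)"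
  by (rule efficient_instr2[where i = "\<lambda>d. SUB d d (Suc d)"]) auto

lemma efficient_lookup:
  assumes f: "efficient \<Gamma> f"
  shows "efficient \<Gamma> (\<lambda>x e. snd x (f x e))"
  unfolding efficient_def
proof (intro allI impI)
  fix rs d assume d: "\<forall>r\<in>set rs. r < d" "(3 :: nat) \<le> d"
  from f d obtain c K q where c: "computes rs \<Gamma> d f c K q" by (rule efficientE)
  let ?c = "c ;; Prim (ADD d d 0) ;; Prim (LOAD d d)" and ?K = "max (Suc d) K"
  have "computes rs \<Gamma> d (\<lambda>x e. snd x (f x e)) ?c ?K (q + 2)"
    unfolding computes_def
  proof (intro allI impI)
    fix n m e R assume R: "memory_ok ?K n m R" "holds rs \<Gamma> (n, m) e R"
    obtain t R1 where 1: "big_step c R t R1" "t \<le> poly q n" "R1 d = f (n, m) e" "preserves d R R1"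
      by (rule computesE[OF c R(1) _ R(2)]) auto
    have R1: "memory_ok ?K n m R1" by (rule memory_ok_preserves[OF R(1) 1(4) d(2)])
    let ?R2 = "snd (exec (ADD d d 0) (0, R1))"
    let ?R3 = "snd (exec (LOAD d d) (0, ?R2))"
    have b: "big_step ?c R (t + (1 + 1)) ?R3"
      by (rule Seq[OF 1(1)], rule Seq; rule big_step_PrimI) (rule refl | simp only: jump_free.simps)+
    have "f (n, m) e + R1 0 \<noteq> d" using R1 by (simp add: memory_ok_def)
    moreover have "R1 (f (n, m) e + R1 0) = m (f (n, m) e)"
      using R1 unfolding memory_ok_def by (metis add.commute)
    ultimately have R3: "?R3 = R1(d := m (f (n, m) e))" using 1(3) by simp
    moreover have "preserves d R ?R3"
    proof -
      have "preserves d R1 ?R3"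
        unfolding R3 by (rule preserves_upd) (use R1 d in \<open>auto simp: memory_ok_def\<close>)
      then show ?thesis
        using 1(4) d by (blast intro: preserves_trans order_refl)
    qed
    ultimately show "\<exists>t R'. big_step ?c R t R' \<and> t \<le> poly (q + 2) n \<and>
        R' d = snd (n, m) (f (n, m) e) \<and> preserves d R R'"
      using 1(2) b by (intro exI[of _ "t + (1 + 1)"] exI[of _ ?R3]) simp
  qed
  then show "\<exists>c K q. computes rs \<Gamma> d (\<lambda>x e. snd x (f x e)) c K q" by blast
qed

definition push :: "'e fn list \<Rightarrow> ('e \<times> nat \<times> nat) fn list" where
  "push \<Gamma> = map (\<lambda>h x p. h x (fst p)) \<Gamma> @ [\<lambda>x p. fst (snd p), \<lambda>x p. snd (snd p)]"

lemma holds_push: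
  assumes "holds rs \<Gamma> g e R"
  shows "holds (rs @ [a, b]) (push \<Gamma>) g (e, R a, R b) R"
  using assms by (auto simp: holds_def push_def list.rel_map intro!: list_all2_appendI)

text \<open>Registers \<open>d\<close>, \<open>d + 1\<close> and \<open>d + 2\<close> hold the
  accumulator, the index and the number of rounds left. The body writes to \<open>d + 3\<close>,
  since it may still read the old accumulator. Its step bound depends on \<open>n\<close> alone and
  not on the accumulator, so nested loops merely multiply polynomials, however large the numbers
  become.\<close>

lemma efficient_fold:
  fixes f :: "nat \<times> (nat \<Rightarrow> nat) \<Rightarrow> 'e \<Rightarrow> nat \<Rightarrow> nat \<Rightarrow> nat"
  assumes a: "efficient \<Gamma> a"
    and f: "efficient (push \<Gamma>) (\<lambda>x p. f x (fst p) (snd (snd p)) (fst (snd p)))"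
  shows "efficient \<Gamma> (\<lambda>x e. rec_nat (a x e) (f x e) (fst x))"
  unfolding efficient_def
proof (intro allI impI)
  fix rs d assume d: "\<forall>r\<in>set rs. r < d" "(3 :: nat) \<le> d"
  from a d obtain c K q where c: "computes rs \<Gamma> d a c K q" by (rule efficientE)
  let ?rs = "rs @ [d, d + 1]"
  have d': "\<forall>r\<in>set ?rs. r < d + 3" "3 \<le> d + 3" using d by auto
  from f d' obtain c' K' q' where
    c': "computes ?rs (push \<Gamma>) (d + 3) (\<lambda>x p. f x (fst p) (snd (snd p)) (fst (snd p))) c' K' q'"
    by (rule efficientE)
  let ?b = "c' ;; Prim (COPY d (d + 3)) ;; Prim (ADD (d + 1) (d + 1) 2) ;; Prim (SUB (d + 2) (d + 2) 2)"
  let ?c = "c ;; Prim (SETC (d + 1) 0) ;; Prim (COPY (d + 2) 1) ;; While (d + 2) ?b"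
  \<comment> \<open>The \<open>5\<close> stands for three register updates, a \<open>JZERO\<close>
    and a \<open>JUMP\<close> in each round, the \<open>3\<close> for two initialisations and the
    last test.\<close>
  let ?K = "max (d + 4) (max K K')" and ?q = "q + 3 + [:0, 1:] * (q' + 5)"
  have loop: "\<exists>t R'. big_step (While (d + 2) ?b) R t R' \<and> t \<le> k * (poly q' n + 5) + 1 \<and>
      R' d = rec_nat s (f (n, m) e) (i + k) \<and> preserves d R R'"
    if "memory_ok ?K n m R" "holds rs \<Gamma> (n, m) e R" "R (d + 2) = k" "R (d + 1) = i"
      "R d = rec_nat s (f (n, m) e) i" for n m e R k i s
    using that
  proof (induction k arbitrary: R i)
    case 0
    then have "big_step (While (d + 2) ?b) R 1 R" by (intro big_step.intros) simp
    then show ?case using 0 by (intro exI[of _ 1] exI[of _ R]) (simp add: preserves_def)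
  next
    case (Suc k)
    have h: "holds ?rs (push \<Gamma>) (n, m) (e, R d, R (d + 1)) R" by (rule holds_push[OF Suc.prems(2)])
    obtain t R1 where 1: "big_step c' R t R1" "t \<le> poly q' n"
      "R1 (d + 3) = f (n, m) e i (R d)" "preserves (d + 3) R R1"
      by (rule computesE[OF c' Suc.prems(1) _ h]) (use Suc.prems(4) in auto)
    let ?R2 = "R1(d := R1 (d + 3), d + 1 := R1 (d + 1) + 1, d + 2 := R1 (d + 2) - 1)"
    have R1: "R1 2 = 1" "R1 (d + 1) = i" "R1 (d + 2) = Suc k" "R1 0 = R 0" "d + 4 \<le> R 0"
      using 1(4) Suc.prems d by (auto simp: preserves_def memory_ok_def)
    have "big_step (Prim (COPY d (d + 3))) R1 1 (R1(d := R1 (d + 3)))"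
      "big_step (Prim (ADD (d + 1) (d + 1) 2)) (R1(d := R1 (d + 3))) 1
         (R1(d := R1 (d + 3), d + 1 := R1 (d + 1) + 1))"
      "big_step (Prim (SUB (d + 2) (d + 2) 2)) (R1(d := R1 (d + 3), d + 1 := R1 (d + 1) + 1)) 1 ?R2"
      using R1(1) d by (intro big_step_PrimI; simp)+
    then have b: "big_step ?b R (t + (1 + (1 + 1))) ?R2"
      using Seq 1(1) by blast
    have p2: "preserves d R ?R2"
      using 1(4) R1 d by (auto simp: preserves_def)
    have "\<exists>t R'. big_step (While (d + 2) ?b) ?R2 t R' \<and> t \<le> k * (poly q' n + 5) + 1 \<and>
      R' d = rec_nat s (f (n, m) e) (Suc i + k) \<and> preserves d ?R2 R'"
    proof (rule Suc.IH)
      show "memory_ok ?K n m ?R2" by (rule memory_ok_preserves[OF Suc.prems(1) p2 d(2)])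
      show "holds rs \<Gamma> (n, m) e ?R2" by (rule holds_preserves[OF Suc.prems(2) p2 d(1)])
    qed (use R1 1(3) Suc.prems in simp_all)
    then obtain t' R' where R': "big_step (While (d + 2) ?b) ?R2 t' R'" "t' \<le> k * (poly q' n + 5) + 1"
      "R' d = rec_nat s (f (n, m) e) (Suc i + k)" "preserves d ?R2 R'" by blast
    have "big_step (While (d + 2) ?b) R ((t + (1 + (1 + 1))) + t' + 2) R'"
      by (rule big_step.While_Suc[OF _ b R'(1)]) (use Suc.prems in simp)
    moreover have "preserves d R R'" using p2 R'(4) d by (blast intro: preserves_trans order_refl)
    ultimately show ?case
      using R'(2,3) 1(2) by (intro exI[of _ "(t + (1 + (1 + 1))) + t' + 2"] exI[of _ R']) simp
  qed
  have "computes rs \<Gamma> d (\<lambda>x e. rec_nat (a x e) (f x e) (fst x)) ?c ?K ?q"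
    unfolding computes_def
  proof (intro allI impI)
    fix n m e R assume R: "memory_ok ?K n m R" "holds rs \<Gamma> (n, m) e R"
    obtain t R1 where 1: "big_step c R t R1" "t \<le> poly q n" "R1 d = a (n, m) e" "preserves d R R1"
      by (rule computesE[OF c R(1) _ R(2)]) auto
    let ?R2 = "R1(d + 1 := 0, d + 2 := n)"
    have R1: "R1 1 = n" "R1 0 = R 0" "d + 4 \<le> R 0"
      using 1(4) R d by (auto simp: preserves_def memory_ok_def)
    have p2: "preserves d R ?R2"
      using 1(4) R1 d by (auto simp: preserves_def)
    have "\<exists>t R'. big_step (While (d + 2) ?b) ?R2 t R' \<and> t \<le> n * (poly q' n + 5) + 1 \<and>
      R' d = rec_nat (a (n, m) e) (f (n, m) e) (0 + n) \<and> preserves d ?R2 R'"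
    proof (rule loop)
      show "memory_ok ?K n m ?R2" by (rule memory_ok_preserves[OF R(1) p2 d(2)])
      show "holds rs \<Gamma> (n, m) e ?R2" by (rule holds_preserves[OF R(2) p2 d(1)])
    qed (use 1(3) in simp_all)
    then obtain t' R' where R': "big_step (While (d + 2) ?b) ?R2 t' R'" "t' \<le> n * (poly q' n + 5) + 1"
      "R' d = rec_nat (a (n, m) e) (f (n, m) e) (0 + n)" "preserves d ?R2 R'" by blast
    have "big_step (Prim (SETC (d + 1) 0)) R1 1 (R1(d + 1 := 0))"
      "big_step (Prim (COPY (d + 2) 1)) (R1(d + 1 := 0)) 1 ?R2"
      using R1(1) d by (intro big_step_PrimI; simp)+
    then have "big_step ?c R (t + (1 + (1 + t'))) R'"
      using Seq 1(1) R'(1) by blast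
    moreover have "preserves d R R'" using p2 R'(4) d by (blast intro: preserves_trans order_refl)
    ultimately show "\<exists>t R'. big_step ?c R t R' \<and> t \<le> poly ?q n \<and>
        R' d = rec_nat (a (n, m) e) (f (n, m) e) (fst (n, m)) \<and> preserves d R R'"
      using R'(2,3) 1(2) by (intro exI[of _ "t + (1 + (1 + t'))"] exI[of _ R']) (simp add: algebra_simps)
  qed
  then show "\<exists>c K q. computes rs \<Gamma> d (\<lambda>x e. rec_nat (a x e) (f x e) (fst x)) c K q" by blast
qed

text \<open>There is no conditional command. Both branches are evaluated, and a loop controlled by
  the condition bit, which its body clears, overwrites the value of the second branch by that of the
  first.\<close>

lemma efficient_if:
  assumes P: "efficient \<Gamma> (\<lambda>x e. of_bool (P x e))" and f: "efficient \<Gamma> f" and g: "efficient \<Gamma> g"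
  shows "efficient \<Gamma> (\<lambda>x e. if P x e then f x e else g x e)"
  unfolding efficient_def
proof (intro allI impI)
  fix rs d assume d: "\<forall>r\<in>set rs. r < d" "(3 :: nat) \<le> d"
  have d1: "\<forall>r\<in>set rs. r < d + 1" "3 \<le> d + 1" and d2: "\<forall>r\<in>set rs. r < d + 2" "3 \<le> d + 2"
    using d by auto
  from P d obtain c K q where c: "computes rs \<Gamma> d (\<lambda>x e. of_bool (P x e)) c K q" by (rule efficientE)
  from f d1 obtain c1 K1 q1 where c1: "computes rs \<Gamma> (d + 1) f c1 K1 q1" by (rule efficientE)
  from g d2 obtain c2 K2 q2 where c2: "computes rs \<Gamma> (d + 2) g c2 K2 q2" by (rule efficientE)
  let ?w = "While d (Prim (COPY (d + 2) (d + 1)) ;; Prim (SETC d 0))"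
  let ?c = "c ;; c1 ;; c2 ;; ?w ;; Prim (COPY d (d + 2))"
  let ?K = "max (d + 3) (max K (max K1 K2))" and ?q = "q + q1 + q2 + 6"
  have "computes rs \<Gamma> d (\<lambda>x e. if P x e then f x e else g x e) ?c ?K ?q"
    unfolding computes_def
  proof (intro allI impI)
    fix n m e R assume R: "memory_ok ?K n m R" "holds rs \<Gamma> (n, m) e R"
    obtain t R1 where 1: "big_step c R t R1" "t \<le> poly q n" "R1 d = of_bool (P (n, m) e)"
      "preserves d R R1"
      by (rule computesE[OF c R(1) _ R(2)]) auto
    have R1: "memory_ok ?K n m R1" "holds rs \<Gamma> (n, m) e R1"
      using memory_ok_preserves[OF R(1) 1(4) d(2)] holds_preserves[OF R(2) 1(4) d(1)] by auto
    obtain t1 R2 where 2: "big_step c1 R1 t1 R2" "t1 \<le> poly q1 n" "R2 (d + 1) = f (n, m) e"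
      "preserves (d + 1) R1 R2"
      by (rule computesE[OF c1 R1(1) _ R1(2)]) auto
    have R2: "memory_ok ?K n m R2" "holds rs \<Gamma> (n, m) e R2"
      using memory_ok_preserves[OF R1(1) 2(4) d1(2)] holds_preserves[OF R1(2) 2(4) d1(1)] by auto
    obtain t2 R3 where 3: "big_step c2 R2 t2 R3" "t2 \<le> poly q2 n" "R3 (d + 2) = g (n, m) e"
      "preserves (d + 2) R2 R3"
      by (rule computesE[OF c2 R2(1) _ R2(2)]) auto
    have R3: "memory_ok ?K n m R3" by (rule memory_ok_preserves[OF R2(1) 3(4) d2(2)])
    have val: "R3 d = of_bool (P (n, m) e)" "R3 (d + 1) = f (n, m) e"
      using 1 2 3 by (auto simp: preserves_def)
    have p3: "preserves d R R3"
      using 1(4) 2(4) 3(4) d by (auto simp: preserves_def)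
    let ?v = "if P (n, m) e then f (n, m) e else g (n, m) e"
    have R30: "d + 3 \<le> R3 0" using R3 by (simp add: memory_ok_def)
    have "\<exists>R4. big_step ?w R3 5 R4 \<and> R4 (d + 2) = ?v \<and> preserves d R3 R4 \<or>
        big_step ?w R3 1 R4 \<and> R4 (d + 2) = ?v \<and> preserves d R3 R4"
    proof (cases "P (n, m) e")
      case False
      then have "big_step ?w R3 1 R3" using val by (intro While_0) simp
      with False val 3(3) show ?thesis by (intro exI[of _ R3]) (simp add: preserves_def)
    next
      case True
      let ?R = "R3(d + 2 := R3 (d + 1), d := 0)"
      have "big_step (Prim (COPY (d + 2) (d + 1)) ;; Prim (SETC d 0)) R3 (1 + 1) ?R"
        by (rule Seq[where ?R1.0 = "R3(d + 2 := R3 (d + 1))"]; rule big_step_PrimI; simp)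
      moreover have "big_step ?w ?R 1 ?R" by (rule While_0) simp
      moreover have "R3 d \<noteq> 0" using val True by simp
      ultimately have "big_step ?w R3 (1 + 1 + 1 + 2) ?R" by (intro While_Suc)
      also have "(1 + 1 + 1 + 2 :: nat) = 5" by simp
      finally have "big_step ?w R3 5 ?R" .
      moreover have "?R (d + 2) = ?v" using val True by simp
      moreover have "preserves d R3 ?R" using R30 by (auto simp: preserves_def)
      ultimately show ?thesis by blast
    qed
    then obtain t3 R4 where 4: "big_step ?w R3 t3 R4" "t3 \<le> 5" "R4 (d + 2) = ?v" "preserves d R3 R4"
      by (metis le_refl one_le_numeral)
    let ?R5 = "R4(d := R4 (d + 2))"
    have 5: "big_step (Prim (COPY d (d + 2))) R4 1 ?R5" by (rule big_step_PrimI) simp_all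
    have "big_step ?c R (t + (t1 + (t2 + (t3 + 1)))) ?R5"
      by (rule Seq[OF 1(1) Seq[OF 2(1) Seq[OF 3(1) Seq[OF 4(1) 5]]]])
    moreover have "?R5 d = ?v" using 4(3) by (simp only: fun_upd_same)
    moreover have "preserves d R ?R5"
    proof -
      have "preserves d R4 ?R5"
        by (rule preserves_upd) (use R30 4(4) d in \<open>auto simp: preserves_def\<close>)
      with p3 4(4) d(2) show ?thesis by (blast intro: preserves_trans order_refl)
    qed
    ultimately show "\<exists>t R'. big_step ?c R t R' \<and> t \<le> poly ?q n \<and> R' d = ?v \<and> preserves d R R'"
      using 1(2) 2(2) 3(2) 4(2)
      by (intro exI[of _ "t + (t1 + (t2 + (t3 + 1)))"] exI[of _ ?R5] conjI) simp_all
  qed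
  then show "\<exists>c K q. computes rs \<Gamma> d (\<lambda>x e. if P x e then f x e else g x e) c K q" by blast
qed

text \<open>Weakening: a program over \<open>\<Gamma>\<close> is reused in another environment by
  telling it in which registers its inputs lie there.\<close>

lemma efficient_reindex:
  assumes f: "efficient \<Gamma> f" and \<phi>: "\<And>h. h \<in> set \<Gamma> \<Longrightarrow> (\<lambda>x e. h x (\<phi> e)) \<in> set \<Delta>"
  shows "efficient \<Delta> (\<lambda>x e. f x (\<phi> e))"
  unfolding efficient_def
proof (intro allI impI)
  fix rs d assume d: "\<forall>r\<in>set rs. r < d" "(3 :: nat) \<le> d"
  have "\<forall>h\<in>set \<Gamma>. \<exists>k<length \<Delta>. \<Delta> ! k = (\<lambda>x e. h x (\<phi> e))"
    using \<phi> by (simp add: in_set_conv_nth)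
  then obtain k where k: "\<And>h. h \<in> set \<Gamma> \<Longrightarrow> k h < length \<Delta> \<and> \<Delta> ! k h = (\<lambda>x e. h x (\<phi> e))" by metis
  \<comment> \<open>Nothing is known yet about the length of \<open>rs\<close>; the default register
    \<open>0\<close> keeps all entries below \<open>d\<close>.\<close>
  let ?rs = "map (\<lambda>h. if k h < length rs then rs ! k h else 0) \<Gamma>"
  have "\<forall>r\<in>set ?rs. r < d" using d by auto
  from f this d(2) obtain c K q where c: "computes ?rs \<Gamma> d f c K q" by (rule efficientE)
  have "holds ?rs \<Gamma> g (\<phi> e) R" if "holds rs \<Delta> g e R" for g e R
    using that k by (auto simp: holds_def list_all2_conv_all_nth)
  with c have "computes rs \<Delta> d (\<lambda>x e. f x (\<phi> e)) c K q"
    unfolding computes_def by blast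
  then show "\<exists>c K q. computes rs \<Delta> d (\<lambda>x e. f x (\<phi> e)) c K q" by blast
qed

lemma efficient_push: "efficient \<Gamma> h \<Longrightarrow> efficient (push \<Gamma>) (\<lambda>x p. h x (fst p))"
  by (rule efficient_reindex) (auto simp: push_def)

lemma efficient_push_acc: "efficient (push \<Gamma>) (\<lambda>x p. fst (snd p))"
  by (rule efficient_var) (simp add: push_def)

lemma efficient_push_index: "efficient (push \<Gamma>) (\<lambda>x p. snd (snd p))"
  by (rule efficient_var) (simp add: push_def)

lemma efficient_cong: "efficient \<Gamma> g \<Longrightarrow> (\<And>x e. f x e = g x e) \<Longrightarrow> efficient \<Gamma> f"
  by presburger

lemma efficient_not: "efficient \<Gamma> (\<lambda>x e. of_bool (P x e)) \<Longrightarrow> efficient \<Gamma> (\<lambda>x e. of_bool (\<not> P x e))"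
  by (rule efficient_cong[OF efficient_diff[OF efficient_const[of _ 1]]]) auto

lemma efficient_if_bool:
  assumes "efficient \<Gamma> (\<lambda>x e. of_bool (P x e))" "efficient \<Gamma> (\<lambda>x e. of_bool (Q x e))" "efficient \<Gamma> (\<lambda>x e. of_bool (R x e))"
  shows "efficient \<Gamma> (\<lambda>x e. of_bool (if P x e then Q x e else R x e))"
  by (rule efficient_cong[OF efficient_if[OF assms]]) auto

lemma efficient_conj:
  assumes "efficient \<Gamma> (\<lambda>x e. of_bool (P x e))" "efficient \<Gamma> (\<lambda>x e. of_bool (Q x e))"
  shows "efficient \<Gamma> (\<lambda>x e. of_bool (P x e \<and> Q x e))"
  by (rule efficient_cong[OF efficient_if[OF assms efficient_const[of _ 0]]]) auto

lemma efficient_disj: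
  assumes "efficient \<Gamma> (\<lambda>x e. of_bool (P x e))" "efficient \<Gamma> (\<lambda>x e. of_bool (Q x e))"
  shows "efficient \<Gamma> (\<lambda>x e. of_bool (P x e \<or> Q x e))"
  by (rule efficient_cong[OF efficient_if[OF assms(1) efficient_const[of _ 1] assms(2)]]) auto

lemma efficient_imp:
  assumes "efficient \<Gamma> (\<lambda>x e. of_bool (P x e))" "efficient \<Gamma> (\<lambda>x e. of_bool (Q x e))"
  shows "efficient \<Gamma> (\<lambda>x e. of_bool (P x e \<longrightarrow> Q x e))"
  by (rule efficient_cong[OF efficient_if[OF assms efficient_const[of _ 1]]]) auto

lemma efficient_iff:
  assumes "efficient \<Gamma> (\<lambda>x e. of_bool (P x e))" "efficient \<Gamma> (\<lambda>x e. of_bool (Q x e))"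
  shows "efficient \<Gamma> (\<lambda>x e. of_bool (P x e = Q x e))"
  by (rule efficient_cong[OF efficient_if[OF assms efficient_not[OF assms(2)]]]) auto

text \<open>With truncated subtraction, the truth value is \<open>1 - (f - g)\<close>.\<close>

lemma efficient_le:
  assumes "efficient \<Gamma> f" "efficient \<Gamma> g"
  shows "efficient \<Gamma> (\<lambda>x e. of_bool (f x e \<le> g x e))"
  by (rule efficient_cong[OF efficient_diff[OF efficient_const[of _ 1] efficient_diff[OF assms]]]) auto

lemma efficient_less:
  assumes "efficient \<Gamma> f" "efficient \<Gamma> g"
  shows "efficient \<Gamma> (\<lambda>x e. of_bool (f x e < g x e))"
  by (rule efficient_cong[OF efficient_not[OF efficient_le[OF assms(2,1)]]]) auto

lemma efficient_eq:
  assumes "efficient \<Gamma> f" "efficient \<Gamma> g"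
  shows "efficient \<Gamma> (\<lambda>x e. of_bool (f x e = g x e))"
  by (rule efficient_cong[OF efficient_conj[OF efficient_le[OF assms] efficient_le[OF assms(2,1)]]]) auto

lemma efficient_sum:
  assumes "efficient (push \<Gamma>) (\<lambda>x p. F x (fst p) (snd (snd p)))"
  shows "efficient \<Gamma> (\<lambda>x e. \<Sum>i<fst x. F x e i)"
proof -
  have "rec_nat 0 (\<lambda>i s. s + F x e i) n = (\<Sum>i<n. F x e i)" for x e n
    by (induction n) auto
  then show ?thesis
    using efficient_fold[OF efficient_const[of _ 0], where f = "\<lambda>x e i s. s + F x e i"] efficient_add[OF efficient_push_acc assms]
    by simp
qed

lemma efficient_bex:
  assumes "efficient (push \<Gamma>) (\<lambda>x p. of_bool (P x (fst p) (snd (snd p))))"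
  shows "efficient \<Gamma> (\<lambda>x e. of_bool (\<exists>i<fst x. P x e i))"
proof -
  have "(\<exists>i<n. Q i) \<longleftrightarrow> 0 < (\<Sum>i<n. of_bool (Q i) :: nat)" for n :: nat and Q
    by (induction n) (auto simp: less_Suc_eq)
  then show ?thesis
    using efficient_less[OF efficient_const[of _ 0] efficient_sum[where F = "\<lambda>x e i. of_bool (P x e i)", OF assms]] by simp
qed

lemma efficient_ball:
  assumes "efficient (push \<Gamma>) (\<lambda>x p. of_bool (P x (fst p) (snd (snd p))))"
  shows "efficient \<Gamma> (\<lambda>x e. of_bool (\<forall>i<fst x. P x e i))"
  using efficient_not[OF efficient_bex[where P = "\<lambda>x e i. \<not> P x e i", OF efficient_not[OF assms]]] by simp

lemmas efficient_intros = efficient_const efficient_size efficient_add efficient_diff efficient_lookup efficient_if efficient_not efficient_if_bool efficient_conj efficient_disj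
  efficient_imp efficient_iff efficient_le efficient_less efficient_eq efficient_sum efficient_bex efficient_ball efficient_push_acc efficient_push_index efficient_push


section \<open>Reading the input\<close>

definition runs :: "cmd \<Rightarrow> store \<Rightarrow> nat \<Rightarrow> store \<Rightarrow> bool" where
  "runs c R b R' \<longleftrightarrow> (\<exists>t\<le>b. big_step c R t R')"

lemma runs_PrimI: "jump_free i \<Longrightarrow> snd (exec i (0, R)) = R' \<Longrightarrow> runs (Prim i) R 1 R'"
  unfolding runs_def using big_step_PrimI by blast

lemma runs_SeqI:
  assumes "runs c R s R1" "runs d R1 t R2"
  shows "runs (c ;; d) R (s + t) R2"
  using assms add_mono Seq unfolding runs_def by meson

lemma runs_mono: "runs c R s R' \<Longrightarrow> s \<le> t \<Longrightarrow> runs c R t R'"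
  unfolding runs_def using le_trans by blast

lemma runs_WhileI:
  assumes "\<And>i. i < k \<Longrightarrow> S i r \<noteq> 0 \<and> runs c (S i) b (S (Suc i))" "S k r = 0"
  shows "runs (While r c) (S 0) (k * (b + 2) + 1) (S k)"
proof -
  \<comment> \<open>The induction counts the rounds still to come, because a loop unfolds at its
    first round.\<close>
  have "runs (While r c) (S (k - i)) (i * (b + 2) + 1) (S k)" if "i \<le> k" for i
    using that
  proof (induction i)
    case 0
    then show ?case using assms(2) While_0 unfolding runs_def by auto
  next
    case (Suc i)
    then have eq: "Suc (k - Suc i) = k - i" by simp
    from Suc obtain t where t: "t \<le> i * (b + 2) + 1" "big_step (While r c) (S (k - i)) t (S k)"
      unfolding runs_def by auto
    from assms(1)[of "k - Suc i"] Suc.prems eq obtain s where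
      s: "S (k - Suc i) r \<noteq> 0" "s \<le> b" "big_step c (S (k - Suc i)) s (S (k - i))"
      unfolding runs_def by auto
    show ?case
      unfolding runs_def
      by (intro exI[of _ "s + t + 2"] conjI While_Suc[of _ _ _ s "S (k - i)" t])
         (use s t in simp_all)
  qed
  from this[of k] show ?thesis by simp
qed

text \<open>The input word starts at register \<open>1\<close>, so no register is free at the beginning. Doubling the
  length \<open>N\<close> of the word, in register \<open>0\<close>, sufficiently often gives an address \<open>M = 2 ^ K * N\<close> beyond
  the word and beyond the first \<open>K\<close> registers, to which the word is moved.\<close>

fun doubles :: "nat \<Rightarrow> cmd" where
  "doubles 0 = Prim (COPY 0 0)"
| "doubles (Suc k) = doubles k ;; Prim (ADD 0 0 0)"

text \<open>A copying loop needs registers of its own, so registers \<open>1\<close> to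
  \<open>K + 1\<close> are saved by unrolled code. The constant \<open>1\<close> that advances the
  pointer can be placed in register \<open>1\<close> only after that register has been
  stored.\<close>

fun saves :: "nat \<Rightarrow> cmd" where
  "saves 0 = Prim (STORE 0 1) ;; Prim (SETC 1 1)"
| "saves (Suc k) = saves k ;; Prim (ADD 0 0 1) ;; Prim (STORE 0 (k + 2))"

lemma runs_doubles: "runs (doubles k) R (k + 1) (R(0 := 2 ^ k * R 0))"
proof (induction k)
  case 0
  show ?case using runs_PrimI[of "COPY 0 0" R "R(0 := 2 ^ 0 * R 0)"] by simp
next
  case (Suc k)
  have "runs (Prim (ADD 0 0 0)) (R(0 := 2 ^ k * R 0)) 1 (R(0 := 2 ^ Suc k * R 0))"
    by (intro runs_PrimI) auto
  from runs_SeqI[OF Suc this] show ?case unfolding doubles.simps by (rule runs_mono) simp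
qed

definition saved :: "store \<Rightarrow> nat \<Rightarrow> nat \<Rightarrow> store" where
  "saved R M k r = (if r = 0 then M + k else if r = 1 then 1
     else if M \<le> r \<and> r \<le> M + k then R (r - M + 1) else R r)"

lemma runs_saves:
  assumes "k + 2 \<le> M"
  shows "runs (saves k) (R(0 := M)) (2 * k + 2) (saved R M k)"
  using assms
proof (induction k)
  case 0
  have "runs (Prim (STORE 0 1)) (R(0 := M)) 1 (R(0 := M, M := R 1))"
    "runs (Prim (SETC 1 1)) (R(0 := M, M := R 1)) 1 (saved R M 0)"
    using 0 by (intro runs_PrimI; force simp: saved_def)+
  from runs_SeqI[OF this] show ?case unfolding saves.simps by (rule runs_mono) simp
next
  case (Suc k)
  have IH: "runs (saves k) (R(0 := M)) (2 * k + 2) (saved R M k)"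
    by (rule Suc.IH) (use Suc.prems in simp)
  have "runs (Prim (ADD 0 0 1)) (saved R M k) 1 ((saved R M k)(0 := M + Suc k))"
    "runs (Prim (STORE 0 (k + 2))) ((saved R M k)(0 := M + Suc k)) 1 (saved R M (Suc k))"
    using Suc.prems by (intro runs_PrimI; auto simp: saved_def fun_eq_iff)+
  from runs_SeqI[OF IH runs_SeqI[OF this]] show ?case unfolding saves.simps by (rule runs_mono) simp
qed

text \<open>The state after \<open>i\<close> rounds of the loop in \<open>copy_bits\<close>:
  registers \<open>3\<close>, \<open>4\<close> and \<open>5\<close> hold the source address, the
  target address and the number of rounds left.\<close>

definition copied :: "store \<Rightarrow> nat \<Rightarrow> nat \<Rightarrow> nat \<Rightarrow> store" where
  "copied R M K i = (\<lambda>r. if M \<le> r \<and> r \<le> M + K + i then R (r - M + 1) else R r)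
     (0 := M, 1 := 1, 2 := K, 3 := K + 2 + i, 4 := M + K + 1 + i, 5 := M - (K + 2) - i,
      6 := if i = 0 then R 6 else R (K + 1 + i))"

text \<open>The word length survives only in the multiple \<open>M\<close>, so every register below
  \<open>M\<close> is copied, including the zeros behind the word. Sources stay below
  \<open>M\<close> and targets above it, so no cell is overwritten before it is read.\<close>

definition copy_bits :: "nat \<Rightarrow> cmd" where
  "copy_bits K = Prim (SETC 2 K) ;; Prim (SUB 0 0 2) ;; Prim (SETC 3 (K + 2)) ;; Prim (ADD 4 0 3) ;;
     Prim (SUB 4 4 1) ;; Prim (SUB 5 0 3) ;;
     While 5 (Prim (LOAD 6 3) ;; Prim (STORE 4 6) ;; Prim (ADD 3 3 1) ;; Prim (ADD 4 4 1) ;;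
       Prim (SUB 5 5 1))"

lemma runs_copy_bits:
  assumes "8 \<le> K" "K + 2 \<le> M"
  shows "runs (copy_bits K) (saved R M K) (7 * M + 7) (copied R M K (M - (K + 2)))"
proof -
  let ?S = "saved R M K"
  let ?S1 = "?S(2 := K)" let ?S2 = "?S1(0 := M)" let ?S3 = "?S2(3 := K + 2)"
  let ?S4 = "?S3(4 := M + K + 2)" let ?S5 = "?S4(4 := M + K + 1)"
  have 1: "runs (Prim (SETC 2 K)) ?S 1 ?S1" "runs (Prim (SUB 0 0 2)) ?S1 1 ?S2"
    "runs (Prim (SETC 3 (K + 2))) ?S2 1 ?S3" "runs (Prim (ADD 4 0 3)) ?S3 1 ?S4"
    "runs (Prim (SUB 4 4 1)) ?S4 1 ?S5" "runs (Prim (SUB 5 0 3)) ?S5 1 (copied R M K 0)"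
    using assms by (intro runs_PrimI; auto simp: saved_def copied_def fun_eq_iff)+
  let ?b = "Prim (LOAD 6 3) ;; Prim (STORE 4 6) ;; Prim (ADD 3 3 1) ;; Prim (ADD 4 4 1) ;;
       Prim (SUB 5 5 1)"
  have "runs (While 5 ?b) (copied R M K 0) ((M - (K + 2)) * (5 + 2) + 1)
    (copied R M K (M - (K + 2)))"
  proof (rule runs_WhileI, intro conjI)
    fix i assume i: "i < M - (K + 2)"
    let ?R = "copied R M K i"
    let ?R1 = "?R(6 := R (K + 2 + i))" let ?R2 = "?R1(M + K + 1 + i := R (K + 2 + i))"
    let ?R3 = "?R2(3 := K + 3 + i)" let ?R4 = "?R3(4 := M + K + 2 + i)"
    show "?R 5 \<noteq> 0" using i by (simp add: copied_def)
    have "runs (Prim (LOAD 6 3)) ?R 1 ?R1" "runs (Prim (STORE 4 6)) ?R1 1 ?R2"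
      "runs (Prim (ADD 3 3 1)) ?R2 1 ?R3" "runs (Prim (ADD 4 4 1)) ?R3 1 ?R4"
      "runs (Prim (SUB 5 5 1)) ?R4 1 (copied R M K (Suc i))"
      using assms i by (intro runs_PrimI; auto simp: copied_def fun_eq_iff)+
    then have "runs ?b ?R (1 + (1 + (1 + (1 + 1)))) (copied R M K (Suc i))"
      by (intro runs_SeqI)
    then show "runs ?b ?R 5 (copied R M K (Suc i))" by (rule runs_mono) simp
  qed (simp add: copied_def)
  with 1 have "runs (copy_bits K) ?S
    (1 + (1 + (1 + (1 + (1 + (1 + ((M - (K + 2)) * (5 + 2) + 1))))))) (copied R M K (M - (K + 2)))"
    unfolding copy_bits_def by (intro runs_SeqI)
  then show ?thesis by (rule runs_mono) simp
qed

text \<open>The dimension is the square root of the word length, of which only a known multiple is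
  at hand. As there is no division, the whole computation stays scaled.\<close>

definition find_size :: "nat \<Rightarrow> cmd" where
  "find_size K = Prim (SETC 2 1) ;; Prim (SETC 1 0) ;; Prim (COPY 3 0) ;; Prim (SETC 4 (2 ^ K)) ;;
     Prim (SETC 5 (2 ^ Suc K)) ;;
     While 3 (Prim (SUB 3 3 4) ;; Prim (ADD 4 4 5) ;; Prim (ADD 1 1 2))"

text \<open>The loop subtracts the odd numbers \<open>2 * i + 1\<close>, scaled by \<open>2 ^ K\<close>.\<close>

lemma runs_find_size:
  assumes "R 0 = 2 ^ K * (n * n)"
  shows "\<exists>R'. runs (find_size K) R (5 * n + 6) R' \<and> R' 1 = n \<and> R' 2 = 1 \<and>
           (\<forall>r. r = 0 \<or> 6 \<le> r \<longrightarrow> R' r = R r)"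
proof -
  define S where "S i = R(1 := i, 2 := 1, 3 := 2 ^ K * (n * n - i * i), 4 := 2 ^ K * (2 * i + 1),
    5 := 2 ^ Suc K)" for i
  let ?S1 = "R(2 := 1)" let ?S2 = "?S1(1 := 0)" let ?S3 = "?S2(3 := R 0)"
  let ?S4 = "?S3(4 := 2 ^ K)"
  have 1: "runs (Prim (SETC 2 1)) R 1 ?S1" "runs (Prim (SETC 1 0)) ?S1 1 ?S2"
    "runs (Prim (COPY 3 0)) ?S2 1 ?S3" "runs (Prim (SETC 4 (2 ^ K))) ?S3 1 ?S4"
    "runs (Prim (SETC 5 (2 ^ Suc K))) ?S4 1 (S 0)"
    using assms by (intro runs_PrimI; auto simp: S_def fun_eq_iff)+
  let ?b = "Prim (SUB 3 3 4) ;; Prim (ADD 4 4 5) ;; Prim (ADD 1 1 2)"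
  have "runs (While 3 ?b) (S 0) (n * (3 + 2) + 1) (S n)"
  proof (rule runs_WhileI, intro conjI)
    fix i assume i: "i < n"
    then have "i * i < n * n" by (simp add: mult_strict_mono)
    then show "S i 3 \<noteq> 0" by (simp add: S_def)
    have d: "S i 3 - S i 4 = 2 ^ K * (n * n - Suc i * Suc i)"
    proof -
      have "n * n - i * i - (2 * i + 1) = n * n - Suc i * Suc i" by simp
      moreover have "S i 3 = 2 ^ K * (n * n - i * i)" "S i 4 = 2 ^ K * (2 * i + 1)"
        by (simp_all add: S_def)
      ultimately show ?thesis by (metis diff_mult_distrib2)
    qed
    let ?R1 = "(S i)(3 := 2 ^ K * (n * n - Suc i * Suc i))"
    let ?R2 = "?R1(4 := 2 ^ K * (2 * Suc i + 1))"
    have "runs (Prim (SUB 3 3 4)) (S i) 1 ?R1"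
      by (rule runs_PrimI) (simp_all only: jump_free.simps exec.simps snd_conv d)
    moreover have "runs (Prim (ADD 4 4 5)) ?R1 1 ?R2"
      "runs (Prim (ADD 1 1 2)) ?R2 1 (S (Suc i))"
      by (intro runs_PrimI; auto simp: S_def fun_eq_iff algebra_simps)+
    ultimately have "runs ?b (S i) (1 + (1 + 1)) (S (Suc i))" by (intro runs_SeqI)
    then show "runs ?b (S i) 3 (S (Suc i))" by (rule runs_mono) simp
  qed (simp add: S_def)
  with 1 have "runs (find_size K) R (1 + (1 + (1 + (1 + (1 + (n * (3 + 2) + 1)))))) (S n)"
    unfolding find_size_def by (intro runs_SeqI)
  then have "runs (find_size K) R (5 * n + 6) (S n)" by (rule runs_mono) simp
  then show ?thesis by (intro exI[of _ "S n"]) (simp add: S_def)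
qed

definition matrix_memory :: "bool list \<Rightarrow> nat \<Rightarrow> nat" where
  "matrix_memory w k = (if k < length w then of_bool (w ! k) else 0)"

lemma runs_prelude:
  assumes "8 \<le> K" "length w = n * n" "0 < n"
  shows "\<exists>R'. runs (doubles K ;; saves K ;; copy_bits K ;; find_size K) (input_store w)
           (7 * (2 ^ K * (n * n)) + 5 * n + 3 * K + 16) R' \<and> memory_ok K n (matrix_memory w) R'"
proof -
  let ?M = "2 ^ K * (n * n)" and ?I = "input_store w"
  have K: "K + 2 \<le> 2 ^ K" using assms(1)
    by (induction rule: nat_induct_at_least) auto
  also have "2 ^ K * 1 \<le> ?M" using assms(3) by (intro mult_le_mono2) simp
  finally have M: "K + 2 \<le> ?M" by simp
  have "2 ^ 1 \<le> (2 :: nat) ^ K" using assms(1) by (intro power_increasing) auto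
  then have "2 * (n * n) \<le> ?M" by (intro mult_le_mono1) simp
  then have N: "length w < ?M" using assms by auto
  have 1: "runs (doubles K) ?I (K + 1) (?I(0 := ?M))"
    using runs_doubles[of K ?I] assms(2) by (simp add: input_store_def)
  have 2: "runs (saves K) (?I(0 := ?M)) (2 * K + 2) (saved ?I ?M K)"
    by (rule runs_saves[OF M])
  have 3: "runs (copy_bits K) (saved ?I ?M K) (7 * ?M + 7) (copied ?I ?M K (?M - (K + 2)))"
    by (rule runs_copy_bits[OF assms(1) M])
  let ?C = "copied ?I ?M K (?M - (K + 2))"
  have C0: "?C 0 = ?M" by (simp add: copied_def)
  \<comment> \<open>The copied block ends at address \<open>2 * ?M - 2\<close>. Behind it the
    registers still have their initial value \<open>0\<close>, and so has the matrix, because the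
    word is shorter than \<open>?M\<close>.\<close>
  have C: "?C (?M + k) = matrix_memory w k" for k
  proof (cases "k \<le> ?M - 2")
    case True
    then have "?C (?M + k) = ?I (k + 1)" using M assms(1) by (auto simp: copied_def)
    then show ?thesis by (simp add: input_store_def matrix_memory_def)
  next
    case False
    then have "?C (?M + k) = ?I (?M + k)" using M assms(1) by (auto simp: copied_def)
    moreover have "length w \<le> k" using False N by linarith
    ultimately show ?thesis using M N assms(3) by (simp add: input_store_def matrix_memory_def)
  qed
  obtain R' where 4: "runs (find_size K) ?C (5 * n + 6) R'" "R' 1 = n" "R' 2 = 1"
    "\<And>r. r = 0 \<or> 6 \<le> r \<Longrightarrow> R' r = ?C r"
    using runs_find_size[where R = ?C, OF C0] by blast
  have "runs (doubles K ;; saves K ;; copy_bits K ;; find_size K) ?I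
    (K + 1 + (2 * K + 2 + (7 * ?M + 7 + (5 * n + 6)))) R'"
    by (rule runs_SeqI[OF 1 runs_SeqI[OF 2 runs_SeqI[OF 3 4(1)]]])
  moreover have "memory_ok K n (matrix_memory w) R'"
    using 4 C C0 M assms(1) by (simp add: memory_ok_def)
  ultimately show ?thesis by (intro exI[of _ R']) (simp add: algebra_simps)
qed

text \<open>The outer loop acts as a conditional. For the empty word the doublings give address
  \<open>0\<close>, so there is no room for the move; the loop is skipped and the \<open>0\<close>
  in register \<open>1\<close> is returned. Otherwise the body leaves the result in register
  \<open>1\<close> and clears register \<open>0\<close>, which ends the loop after one
  round.\<close>

lemma runs_program:
  assumes "efficient [] (f :: unit fn)"
  shows "\<exists>c (q :: nat poly). \<forall>n w. length w = n * n \<longrightarrow>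
    (\<exists>R. runs c (input_store w) (poly q n) R \<and>
       R 0 = (if n = 0 then 0 else f (n, matrix_memory w) ()))"
proof -
  from assms have "\<exists>c K q. computes [] [] 3 f c K q"
    unfolding efficient_def by simp
  then obtain c K' q where c: "computes [] [] 3 f c K' q" by blast
  define K where "K = max 8 K'"
  let ?pre = "doubles K ;; saves K ;; copy_bits K ;; find_size K"
  let ?main = "(doubles K ;; saves K ;; copy_bits K ;; find_size K) ;; c ;;
    Prim (COPY 1 3) ;; Prim (SETC 0 0)"
  let ?p = "[:3 * K + 24, 5, 7 * 2 ^ K:] + q"
  show ?thesis
  proof (intro exI[of _ "While 0 ?main ;; Prim (COPY 0 1)"] exI[of _ ?p] allI impI)
    fix n :: nat and w :: "bool list" assume w: "length w = n * n"
    let ?I = "input_store w"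
    show "\<exists>R. runs (While 0 ?main ;; Prim (COPY 0 1)) ?I (poly ?p n) R \<and>
       R 0 = (if n = 0 then 0 else f (n, matrix_memory w) ())"
    proof (cases "n = 0")
      case True
      then have "runs (While 0 ?main) ?I (0 * (0 + 2) + 1) ?I"
        using w by (intro runs_WhileI[where S = "\<lambda>i. ?I"]) (simp_all add: input_store_def)
      moreover have "runs (Prim (COPY 0 1)) ?I 1 (?I(0 := 0))"
        by (rule runs_PrimI) (use w True in \<open>auto simp: input_store_def\<close>)
      ultimately have "runs (While 0 ?main ;; Prim (COPY 0 1)) ?I (0 * (0 + 2) + 1 + 1) (?I(0 := 0))"
        by (rule runs_SeqI)
      then have "runs (While 0 ?main ;; Prim (COPY 0 1)) ?I (poly ?p n) (?I(0 := 0))"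
        by (rule runs_mono) simp
      with True show ?thesis by (intro exI[of _ "?I(0 := 0)"]) simp
    next
      case False
      obtain R1 where R1: "runs ?pre ?I (7 * (2 ^ K * (n * n)) + 5 * n + 3 * K + 16) R1"
        "memory_ok K n (matrix_memory w) R1"
        using runs_prelude[of K w n] w False by (auto simp: K_def)
      have "\<exists>R2. runs c R1 (poly q n) R2 \<and> R2 3 = f (n, matrix_memory w) ()"
        by (rule computesE[OF c R1(2), where e = "()"]) (auto simp: K_def holds_def runs_def)
      then obtain R2 where R2: "runs c R1 (poly q n) R2" "R2 3 = f (n, matrix_memory w) ()" by blast
      let ?R3 = "R2(1 := R2 3)" let ?R4 = "?R3(0 := 0)"
      have 3: "runs (Prim (COPY 1 3)) R2 1 ?R3" "runs (Prim (SETC 0 0)) ?R3 1 ?R4"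
        by (intro runs_PrimI; simp)+
      let ?t = "7 * (2 ^ K * (n * n)) + 5 * n + 3 * K + 16 + (poly q n + (1 + 1))"
      have main: "runs ?main ?I ?t ?R4"
        by (intro runs_SeqI[OF R1(1)] runs_SeqI[OF R2(1)] runs_SeqI[OF 3])
      have I0: "?I 0 \<noteq> 0" using w False by (simp add: input_store_def)
      define S where "S i = (if i = 0 then ?I else ?R4)" for i :: nat
      have S: "S 0 = ?I" "S 1 = ?R4" unfolding S_def by (rule if_P, simp, rule if_not_P, simp)
      have "runs (While 0 ?main) (S 0) (1 * (?t + 2) + 1) (S 1)"
      proof (rule runs_WhileI, intro conjI)
        fix i :: nat assume "i < 1"
        then have i: "i = 0" by simp
        show "S i 0 \<noteq> 0" using I0 unfolding i S .
        show "runs ?main (S i) ?t (S (Suc i))" using main unfolding i S One_nat_def[symmetric] .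
      qed (simp add: S(2)[unfolded One_nat_def])
      moreover have "runs (Prim (COPY 0 1)) (S 1) 1 (?R4(0 := R2 3))"
        unfolding S by (rule runs_PrimI) simp_all
      ultimately have "runs (While 0 ?main ;; Prim (COPY 0 1)) (S 0) (1 * (?t + 2) + 1 + 1)
          (?R4(0 := R2 3))"
        by (rule runs_SeqI)
      then have "runs (While 0 ?main ;; Prim (COPY 0 1)) ?I (poly ?p n) (?R4(0 := R2 3))"
        unfolding S by (rule runs_mono) (simp add: algebra_simps)
      with False R2(2) show ?thesis by (intro exI[of _ "?R4(0 := R2 3)"]) simp
    qed
  qed
qed

lemma poly_nat_mono: "x \<le> y \<Longrightarrow> poly p x \<le> poly p y" for p :: "nat poly"
  by (induction p) (auto intro!: add_mono mult_mono)

lemma finite_operands: "finite (\<Union> (operands ` set P))"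
proof -
  have "finite (operands i)" for i by (cases i) auto
  then show ?thesis by simp
qed

theorem poly_time_computableI:
  fixes f :: "unit fn" and dim :: "'i \<Rightarrow> nat" and X :: "'i set"
  assumes f: "efficient [] f"
    and len: "\<And>x. x \<in> X \<Longrightarrow> length (encode x) = dim x * dim x"
    and h: "\<And>x. x \<in> X \<Longrightarrow> h x = (if dim x = 0 then 0 else f (dim x, matrix_memory (encode x)) ())"
  shows "poly_time_computable X encode h"
proof -
  obtain c and q :: "nat poly" where c: "\<And>n w. length w = n * n \<Longrightarrow>
    (\<exists>R. runs c (input_store w) (poly q n) R \<and>
       R 0 = (if n = 0 then 0 else f (n, matrix_memory w) ()))"
    using runs_program[OF f] by blast
  let ?P = "code 0 c"
  obtain b where "\<forall>a \<in> \<Union> (operands ` set ?P). a < b"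
    using finite_operands[of ?P] unfolding finite_nat_set_iff_bounded ..
  then have b: "\<And>a. a \<in> \<Union> (operands ` set ?P) \<Longrightarrow> a < b" by blast
  \<comment> \<open>The polynomial \<open>[:b + 1, 1:]\<close> is the initial digit bound:
    \<open>b\<close> covers the constants of the program, the word length covers the input store.
    Bounding the number of digits by the number itself is crude but enough.\<close>
  define p where "p = q * ([:5:] * ([:b + 1, 1:] + q))"
  have "\<exists>t R. halts_with ?P (0, input_store (encode x)) t R \<and> R 0 = h x \<and>
      t \<le> poly p (length (encode x))" if x: "x \<in> X" for x
  proof -
    let ?w = "encode x" and ?n = "dim x"
    let ?b = "b + 1 + length ?w"
    obtain R t where R: "big_step c (input_store ?w) t R" "t \<le> poly q ?n"
      "R 0 = (if ?n = 0 then 0 else f (?n, matrix_memory ?w) ())"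
      using c[OF len[OF x]] unfolding runs_def by blast
    have lt: "a < 2 ^ ?b" if "a < ?b" for a
      using that less_exp[of ?b] by (rule less_trans)
    have "input_store ?w a < 2 ^ ?b" for a
      by (rule lt) (auto simp: input_store_def)
    moreover have "a < 2 ^ ?b" if "a \<in> \<Union> (operands ` set ?P)" for a
      by (rule lt) (use b[OF that] in simp)
    ultimately obtain t' where t': "halts_with ?P (0, input_store ?w) t' R" "t' \<le> t * (5 * (?b + t))"
      using halts_in_cost[OF halts_in_big_step[OF R(1)], of ?b] by auto
    have "?n \<le> length ?w" using len[OF x] by simp
    then have "t \<le> poly q (length ?w)"
      using R(2) poly_nat_mono le_trans by blast
    then have "t * (5 * (?b + t)) \<le> poly q (length ?w) * (5 * (?b + poly q (length ?w)))"
      by (intro mult_mono add_mono) auto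
    also have "\<dots> = poly p (length ?w)"
      by (simp add: p_def algebra_simps)
    finally show ?thesis
      using t' R(3) h[OF x] le_trans by metis
  qed
  then show ?thesis
    unfolding poly_time_computable_def computes_in_poly_time_def by blast
qed

section \<open>Counting closed sets\<close>

definition closed_under :: "('a \<times> 'a) set \<Rightarrow> 'a set \<Rightarrow> bool" where
  "closed_under E C \<longleftrightarrow> (\<forall>x y. (x, y) \<in> E \<longrightarrow> x \<in> C \<longrightarrow> y \<in> C)"

lemma closed_under_rtrancl:
  assumes "closed_under E C" "(x, y) \<in> E\<^sup>*" "x \<in> C"
  shows "y \<in> C"
  using assms(2,1,3) by (induction rule: rtrancl_induct) (auto simp: closed_under_def)

definition forced_in :: "('a \<times> 'a) set \<Rightarrow> 'a set \<Rightarrow> 'a set \<Rightarrow> 'a set" where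
  "forced_in E V I = {y \<in> V. \<exists>x\<in>I. (x, y) \<in> E\<^sup>*}"

definition undecided :: "('a \<times> 'a) set \<Rightarrow> 'a set \<Rightarrow> 'a set \<Rightarrow> 'a set \<Rightarrow> 'a set" where
  "undecided E V I X = {y \<in> V. \<not> (\<exists>x\<in>I. (x, y) \<in> E\<^sup>*) \<and> \<not> (\<exists>x\<in>X. (y, x) \<in> E\<^sup>*)}"

definition leaders :: "('a :: linorder \<times> 'a) set \<Rightarrow> 'a set \<Rightarrow> 'a set" where
  "leaders E F = {x \<in> F. \<forall>y\<in>F. (x, y) \<in> E\<^sup>* \<longrightarrow> x \<le> y}"

text \<open>A vertex outside \<open>F\<close> is forced into \<open>C\<close> or reaches
  \<open>X\<close> and is barred from it. An arc that leaves \<open>F\<close> ends in a forced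
  vertex, for otherwise its source would reach \<open>X\<close> as well. Inside \<open>F\<close>
  arcs are symmetric, so each component, represented by its least vertex, lies in \<open>C\<close>
  entirely or not at all. The factor \<open>0\<close> on \<open>X\<close> covers contradictory
  requirements.\<close>

lemma sum_closed_symmetric:
  fixes V :: "'a :: linorder set" and p :: "'a \<Rightarrow> nat"
  assumes V: "finite V" "E \<subseteq> V \<times> V" "I \<subseteq> V" "X \<subseteq> V"
    and F: "F = undecided E V I X"
    and sym: "\<And>x y. x \<in> F \<Longrightarrow> y \<in> F \<Longrightarrow> (x, y) \<in> E \<Longrightarrow> (y, x) \<in> E"
  shows "(\<Sum>C | C \<subseteq> V \<and> closed_under E C \<and> I \<subseteq> C \<and> C \<inter> X = {}. prod p C) =
    (\<Prod>y\<in>forced_in E V I. if y \<in> X then 0 else p y) *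
    (\<Prod>x\<in>leaders E F. 1 + (\<Prod>y | y \<in> F \<and> (x, y) \<in> E\<^sup>*. p y))"
    (is "?lhs = ?rhs")
proof (cases "forced_in E V I \<inter> X = {}")
  case False
  then obtain x y where xy: "y \<in> V" "x \<in> I" "(x, y) \<in> E\<^sup>*" "y \<in> X"
    by (auto simp: forced_in_def)
  have "(\<Prod>y\<in>forced_in E V I. if y \<in> X then 0 else p y) = 0"
    by (rule prod_zero) (use xy V(1) in \<open>auto simp: forced_in_def\<close>)
  moreover have "\<not> (closed_under E C \<and> I \<subseteq> C \<and> C \<inter> X = {})" for C
    using xy closed_under_rtrancl[of E C x y] by blast
  then have none: "{C. C \<subseteq> V \<and> closed_under E C \<and> I \<subseteq> C \<and> C \<inter> X = {}} = {}" by blast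
  ultimately show ?thesis unfolding none by simp
next
  case True
  let ?I = "forced_in E V I"
  define comp where "comp x = {y \<in> F. (x, y) \<in> E\<^sup>*}" for x
  have fin: "finite ?I" "finite F" "finite (leaders E F)" "finite (comp x)" for x
    using V(1) F by (auto simp: forced_in_def undecided_def leaders_def comp_def)
  \<comment> \<open>Paths between vertices of \<open>F\<close> do not leave \<open>F\<close>, so
    they can be reversed arc by arc.\<close>
  have between: "y \<in> F" if "x \<in> F" "(x, y) \<in> E\<^sup>*" "(y, z) \<in> E\<^sup>*" "z \<in> F" for x y z
  proof -
    have "y \<in> V" by (rule rtranclE[OF that(2)]) (use that(1) V(2) F in \<open>auto simp: undecided_def\<close>)
    with that show ?thesis unfolding F undecided_def by (blast intro: rtrancl_trans)
  qed
  have return: "(y, x) \<in> E\<^sup>*" if "(x, y) \<in> E\<^sup>*" "x \<in> F" "y \<in> F" for x y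
    using that
  proof (induction rule: rtrancl_induct)
    case (step y z)
    have "y \<in> F" by (rule between[of x y z]) (use step in auto)
    with step sym show ?case by (meson converse_rtrancl_into_rtrancl)
  qed simp
  have leader: "\<exists>l. l \<in> leaders E F \<and> x \<in> comp l" if "x \<in> F" for x
  proof -
    let ?l = "Min (comp x)"
    have x: "x \<in> comp x" using that by (simp add: comp_def)
    then have l: "?l \<in> comp x" using fin(4) by (intro Min_in) auto
    then have "(?l, x) \<in> E\<^sup>*" using return[of x ?l] that by (simp add: comp_def)
    moreover have "?l \<le> y" if "y \<in> F" "(?l, y) \<in> E\<^sup>*" for y
      using that l fin(4) rtrancl_trans[of x ?l E y] by (intro Min_le) (auto simp: comp_def)
    ultimately show ?thesis using l that by (intro exI[of _ ?l]) (auto simp: comp_def leaders_def)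
  qed
  have leader_unique: "l = l'" if "l \<in> leaders E F" "l' \<in> leaders E F" "x \<in> comp l" "x \<in> comp l'"
    for l l' x
  proof -
    have "(l, l') \<in> E\<^sup>*" "(l', l) \<in> E\<^sup>*"
      using that return[of l x] return[of l' x] rtrancl_trans[of l x E l'] rtrancl_trans[of l' x E l]
      by (auto simp: comp_def leaders_def)
    with that show ?thesis by (auto simp: leaders_def intro: antisym)
  qed
  let ?S = "{C. C \<subseteq> V \<and> closed_under E C \<and> I \<subseteq> C \<and> C \<inter> X = {}}"
  let ?U = "\<lambda>T. ?I \<union> \<Union> (comp ` T)"
  have U_S: "?U T \<in> ?S" if "T \<subseteq> leaders E F" for T
  proof -
    have "closed_under E (?U T)"
      unfolding closed_under_def
    proof (intro allI impI)
      fix x y assume xy: "(x, y) \<in> E" "x \<in> ?U T"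
      then have y: "y \<in> V" using V(2) by auto
      show "y \<in> ?U T"
      proof (cases "x \<in> ?I")
        case True
        with xy y show ?thesis by (auto simp: forced_in_def intro: rtrancl_into_rtrancl)
      next
        case False
        with xy obtain l where l: "l \<in> T" "x \<in> comp l" by auto
        show ?thesis
        proof (cases "y \<in> ?I")
          case False
          have "y \<in> F"
            using False l(2) y xy(1) unfolding F undecided_def forced_in_def comp_def
            by (auto intro: converse_rtrancl_into_rtrancl)
          with l xy show ?thesis by (auto simp: comp_def intro: rtrancl_into_rtrancl)
        qed simp
      qed
    qed
    moreover have "I \<subseteq> ?I" using V(3) by (auto simp: forced_in_def)
    moreover have "comp l \<inter> X = {}" "comp l \<subseteq> V" for l
      by (auto simp: comp_def F undecided_def)
    moreover have "?I \<subseteq> V" by (auto simp: forced_in_def)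
    ultimately show ?thesis using True by blast
  qed
  have U_inter: "?U T \<inter> leaders E F = T" if "T \<subseteq> leaders E F" for T
  proof
    show "T \<subseteq> ?U T \<inter> leaders E F" using that by (force simp: comp_def leaders_def)
    show "?U T \<inter> leaders E F \<subseteq> T"
    proof
      fix x assume x: "x \<in> ?U T \<inter> leaders E F"
      then have "x \<in> F" by (simp add: leaders_def)
      then have "x \<notin> ?I" by (simp add: F undecided_def forced_in_def)
      with x obtain l where "l \<in> T" "x \<in> comp l" by auto
      moreover have "x \<in> comp x" using \<open>x \<in> F\<close> by (simp add: comp_def)
      ultimately show "x \<in> T" using leader_unique[of l x x] x that by auto
    qed
  qed
  have S_U: "?U (C \<inter> leaders E F) = C" if C: "C \<in> ?S" for C
  proof
    have cl: "closed_under E C" using C by simp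
    show "?U (C \<inter> leaders E F) \<subseteq> C"
      using C closed_under_rtrancl[OF cl] by (auto simp: forced_in_def comp_def)
    show "C \<subseteq> ?U (C \<inter> leaders E F)"
    proof
      fix x assume x: "x \<in> C"
      have "x \<in> ?I \<or> x \<in> F"
        using x C closed_under_rtrancl[OF cl _ x] unfolding F undecided_def forced_in_def by blast
      then show "x \<in> ?U (C \<inter> leaders E F)"
      proof
        assume "x \<in> F"
        from leader[OF this] obtain l where l: "l \<in> leaders E F" "x \<in> comp l" by blast
        with \<open>x \<in> F\<close> return[of l x] have "(x, l) \<in> E\<^sup>*" by (auto simp: comp_def leaders_def)
        with closed_under_rtrancl[OF cl _ x] have "l \<in> C" by blast
        with l show ?thesis by auto
      qed simp
    qed
  qed
  have prod_U: "prod p (?U T) = prod p ?I * (\<Prod>l\<in>T. prod p (comp l))" if T: "T \<subseteq> leaders E F" for T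
  proof -
    have finT: "finite T" using fin(3) T by (rule rev_finite_subset)
    have "prod p (?U T) = prod p ?I * prod p (\<Union> (comp ` T))"
      by (rule prod.union_disjoint) (use fin finT in \<open>auto simp: comp_def F undecided_def forced_in_def\<close>)
    also have "prod p (\<Union> (comp ` T)) = (\<Prod>l\<in>T. prod p (comp l))"
      by (rule prod.UNION_disjoint) (use fin finT T leader_unique in blast)+
    finally show ?thesis .
  qed
  have "?lhs = (\<Sum>T\<in>Pow (leaders E F). prod p ?I * (\<Prod>l\<in>T. prod p (comp l)))"
    by (rule sum.reindex_bij_witness[where i = ?U and j = "\<lambda>C. C \<inter> leaders E F"])
       (use U_S U_inter S_U prod_U in \<open>simp_all flip: prod_U\<close>)
  also have "\<dots> = prod p ?I * (\<Sum>T\<in>Pow (leaders E F). \<Prod>l\<in>T. prod p (comp l))"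
    by (simp add: sum_distrib_left)
  also have "(\<Sum>T\<in>Pow (leaders E F). \<Prod>l\<in>T. prod p (comp l)) =
      (\<Prod>l\<in>leaders E F. prod p (comp l) + 1)"
    using prod_add[OF fin(3), of "\<lambda>l. prod p (comp l)" "\<lambda>_. 1"] by simp
  also have "prod p ?I = (\<Prod>y\<in>?I. if y \<in> X then 0 else p y)"
    by (rule prod.cong) (use True in auto)
  finally show ?thesis by (simp add: comp_def add.commute)
qed

section \<open>Maximal generators of a closed set\<close>

definition rank_in :: "('a \<times> 'a) set \<Rightarrow> 'a set \<Rightarrow> 'a \<Rightarrow> nat" where
  "rank_in E V x = card {y \<in> V. (x, y) \<in> E\<^sup>*}"

text \<open>A vertex that reaches another one has at least its rank, and the same rank only if the
  two are equivalent. Breaking ties by \<open><\<close> makes the order linear, hence the generators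
  unique.\<close>

definition below :: "('a :: linorder \<times> 'a) set \<Rightarrow> 'a set \<Rightarrow> 'a \<Rightarrow> 'a \<Rightarrow> bool" where
  "below E V x y \<longleftrightarrow> rank_in E V x < rank_in E V y \<or> rank_in E V x = rank_in E V y \<and> x < y"

lemma below_linear:
  "\<not> below E V x x" "below E V x y \<Longrightarrow> below E V y z \<Longrightarrow> below E V x z"
  "below E V x y \<or> x = y \<or> below E V y x"
  by (auto simp: below_def)

lemma ex_below_max:
  assumes "finite A" "A \<noteq> {}"
  shows "\<exists>x\<in>A. \<forall>y\<in>A. \<not> below E V x y"
  using assms
proof (induction rule: finite_ne_induct)
  case (singleton x)
  then show ?case using below_linear(1) by auto
next
  case (insert x A)
  then obtain m where m: "m \<in> A" "\<forall>y\<in>A. \<not> below E V m y" by auto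
  show ?case
  proof (cases "below E V m x")
    case True
    then show ?thesis using m below_linear by (metis insert_iff)
  next
    case False
    then show ?thesis using m by auto
  qed
qed

text \<open>The generators of a closed set \<open>C\<close> are its greatest element \<open>x\<close> and the greatest element \<open>y\<close>
  of a class other than that of \<open>x\<close> that is not already reached from \<open>x\<close>. The convention \<open>y = x\<close>
  means that there is no such element.\<close>

definition generators ::
    "('a :: linorder \<times> 'a) set \<Rightarrow> 'a set \<Rightarrow> ('a \<Rightarrow> 'b) \<Rightarrow> 'a \<Rightarrow> 'a \<Rightarrow> bool" where
  "generators E V \<kappa> x y \<longleftrightarrow> y = x \<or> \<kappa> y \<noteq> \<kappa> x \<and> (x, y) \<notin> E\<^sup>* \<and> below E V y x"

text \<open>Avoiding this set makes \<open>x\<close> and \<open>y\<close> the generators of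
  \<open>C\<close>, so prescribing generators is a constraint of the kind that
  \<open>sum_closed_symmetric\<close> admits.\<close>

definition excluded ::
    "('a :: linorder \<times> 'a) set \<Rightarrow> 'a set \<Rightarrow> ('a \<Rightarrow> 'b) \<Rightarrow> 'a \<Rightarrow> 'a \<Rightarrow> 'a set" where
  "excluded E V \<kappa> x y = {z \<in> V. below E V x z \<or>
     \<kappa> z \<noteq> \<kappa> x \<and> (x, z) \<notin> E\<^sup>* \<and> (y = x \<or> below E V y z)}"

lemma ex1_generators:
  assumes "finite V" "C \<subseteq> V" "C \<noteq> {}"
  shows "\<exists>!g. g \<in> C \<times> C \<and> generators E V \<kappa> (fst g) (snd g) \<and> C \<inter> excluded E V \<kappa> (fst g) (snd g) = {}"
proof -
  have fin: "finite C" using assms by (auto intro: finite_subset)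
  from ex_below_max[OF fin assms(3)] obtain x where x: "x \<in> C" "\<forall>y\<in>C. \<not> below E V x y" by blast
  let ?A = "{z \<in> C. \<kappa> z \<noteq> \<kappa> x \<and> (x, z) \<notin> E\<^sup>*}"
  have "\<exists>y. (if ?A = {} then y = x else y \<in> ?A \<and> (\<forall>z\<in>?A. \<not> below E V y z))"
    using ex_below_max[of ?A E V] fin by auto
  then obtain y where y: "if ?A = {} then y = x else y \<in> ?A \<and> (\<forall>z\<in>?A. \<not> below E V y z)" by blast
  show ?thesis
  proof (rule ex1I[of _ "(x, y)"])
    show "(x, y) \<in> C \<times> C \<and> generators E V \<kappa> (fst (x, y)) (snd (x, y)) \<and>
        C \<inter> excluded E V \<kappa> (fst (x, y)) (snd (x, y)) = {}"
    proof (cases "?A = {}")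
      case True
      with x y show ?thesis by (auto simp: generators_def excluded_def)
    next
      case False
      with y have y: "y \<in> ?A" "\<forall>z\<in>?A. \<not> below E V y z" by (auto simp only: if_False)
      then have "y \<noteq> x" "\<not> below E V x y" using x by auto
      then have "below E V y x" using below_linear(3) by blast
      with x y \<open>y \<noteq> x\<close> show ?thesis by (auto simp: generators_def excluded_def)
    qed
  next
    fix g assume g: "g \<in> C \<times> C \<and> generators E V \<kappa> (fst g) (snd g) \<and>
        C \<inter> excluded E V \<kappa> (fst g) (snd g) = {}"
    obtain a b where ab: "g = (a, b)" by fastforce
    have C: "z \<in> V" if "z \<in> C" for z using that assms by auto
    have "\<not> below E V a x" using g ab x C by (auto simp: excluded_def)
    with x g ab have a: "a = x" using below_linear(3) by fastforce
    have "b = y"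
    proof (cases "b = x")
      case True
      then have "?A = {}" using g ab a C by (auto simp: excluded_def)
      with y True show ?thesis by simp
    next
      case False
      then have "b \<in> ?A" using g ab a by (auto simp: generators_def)
      with y have y': "y \<in> ?A" "\<not> below E V y b" by (auto split: if_splits)
      moreover have "\<not> below E V b y" using g ab a C y' by (auto simp: excluded_def)
      ultimately show ?thesis using below_linear(3) by blast
    qed
    with a ab show "g = (x, y)" by simp
  qed
qed

text \<open>Every \<open>C\<close> contains \<open>I\<close>, so it is nonempty and has exactly one
  pair of generators, by which the sum is split.\<close>

lemma sum_closed_generators:
  fixes p :: "'a :: linorder \<Rightarrow> nat"
  assumes "finite V" "I \<noteq> {}"
  shows "(\<Sum>C | C \<subseteq> V \<and> closed_under E C \<and> I \<subseteq> C. prod p C) =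
    (\<Sum>x\<in>V. \<Sum>y\<in>V. if generators E V \<kappa> x y
      then \<Sum>C | C \<subseteq> V \<and> closed_under E C \<and> insert x (insert y I) \<subseteq> C \<and>
        C \<inter> excluded E V \<kappa> x y = {}. prod p C
      else 0)"
proof -
  let ?S = "{C. C \<subseteq> V \<and> closed_under E C \<and> I \<subseteq> C}"
  let ?g = "\<lambda>C g. g \<in> C \<times> C \<and> generators E V \<kappa> (fst g) (snd g) \<and>
      C \<inter> excluded E V \<kappa> (fst g) (snd g) = {}"
  have fin: "finite ?S" by (rule finite_subset[of _ "Pow V"]) (use assms in auto)
  have one: "(\<Sum>g\<in>V \<times> V. if ?g C g then prod p C else 0) = prod p C" if "C \<in> ?S" for C
  proof -
    have C: "C \<subseteq> V" "C \<noteq> {}" using that assms(2) by auto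
    obtain g where g: "?g C g" "\<forall>h. ?g C h \<longrightarrow> h = g"
      by (rule ex1E[OF ex1_generators[OF assms(1) C, of E \<kappa>]])
    then have iff: "?g C h \<longleftrightarrow> h = g" for h by metis
    have "(\<Sum>h\<in>V \<times> V. if ?g C h then prod p C else 0) = (\<Sum>h\<in>V \<times> V. if h = g then prod p C else 0)"
      by (simp only: iff)
    also have "\<dots> = prod p C" using g(1) C assms(1) by (subst sum.delta) auto
    finally show ?thesis .
  qed
  have "sum (prod p) ?S = (\<Sum>C\<in>?S. \<Sum>g\<in>V \<times> V. if ?g C g then prod p C else 0)"
    by (rule sum.cong) (simp_all only: one)
  also have "\<dots> = (\<Sum>g\<in>V \<times> V. \<Sum>C\<in>?S. if ?g C g then prod p C else 0)"
    by (rule sum.swap)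
  also have "\<dots> = (\<Sum>(x, y)\<in>V \<times> V. if generators E V \<kappa> x y
      then \<Sum>C | C \<subseteq> V \<and> closed_under E C \<and> insert x (insert y I) \<subseteq> C \<and>
        C \<inter> excluded E V \<kappa> x y = {}. prod p C
      else 0)"
    using fin by (intro sum.cong refl)
      (auto simp flip: sum.inter_filter intro!: sum.cong)
  finally show ?thesis by (simp add: sum.cartesian_product)
qed

text \<open>Read \<open>s x\<close> as \<open>x\<close> lying in the first part, if \<open>x\<close> lies in one of the two parts at all, and \<open>a y\<close>,
  \<open>c y\<close> as the adjacency of \<open>y\<close> to the first and the second part. An arc from \<open>x\<close> to \<open>y\<close> says that \<open>y\<close>
  cannot stay outside the two parts if \<open>x\<close> lies in one of them.\<close>

definition deviation ::
    "'a set \<Rightarrow> ('a \<Rightarrow> 'a \<Rightarrow> bool) \<Rightarrow> ('a \<Rightarrow> bool) \<Rightarrow> ('a \<Rightarrow> bool) \<Rightarrow> ('a \<Rightarrow> bool) \<Rightarrow> ('a \<times> 'a) set" where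
  "deviation V adj s a c =
     {(x, y). x \<in> V \<and> y \<in> V \<and> adj x y \<noteq> (if s x then a y else c y)}"

text \<open>For two vertices \<open>x\<close>, \<open>y\<close> either both arcs or none are present, or at least one is present,
  and the classes of \<open>x\<close> and \<open>y\<close> tell which alternative holds. In the second alternative a maximal
  generator that does not reach \<open>y\<close> is reached from \<open>y\<close>, so maximality makes them equivalent. Hence
  all undecided vertices are related to the generators by the first alternative.\<close>

lemma undecided_symmetric:
  fixes V :: "'a :: linorder set"
  defines "\<kappa> \<equiv> \<lambda>s a c x. (s x, a x, c x)"
  assumes V: "finite V" and adj: "\<And>x y. adj x y = adj y x"
    and E: "E = deviation V adj s a c"
    and gen: "x1 \<in> V" "x2 \<in> V" "generators E V (\<kappa> s a c) x1 x2"
    and IX: "x1 \<in> I" "x2 \<in> I" "excluded E V (\<kappa> s a c) x1 x2 \<subseteq> X"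
    and pq: "p \<in> undecided E V I X" "q \<in> undecided E V I X" "(p, q) \<in> E"
  shows "(q, p) \<in> E"
proof -
  \<comment> \<open>This is the second alternative: the two arcs compare \<open>adj x y\<close> with
    different bits. It is symmetric and depends only on the two classes.\<close>
  define T where "T x y \<longleftrightarrow> (if s x then a y else c y) \<noteq> (if s y then a x else c x)" for x y
  let ?F = "undecided E V I X"
  have E_V: "x \<in> V" "y \<in> V" if "(x, y) \<in> E" for x y
    using that by (auto simp: E deviation_def)
  have T: "(x, y) \<in> E \<or> (y, x) \<in> E" if "T x y" "x \<in> V" "y \<in> V" for x y
    using that adj[of x y] by (auto simp: T_def E deviation_def split: if_splits)
  have not_T: "(y, x) \<in> E" if "\<not> T x y" "(x, y) \<in> E" for x y
    using that adj[of x y] by (auto simp: T_def E deviation_def split: if_splits)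
  have max: "\<not> T x z" if x: "x \<in> V" and z: "z \<in> V" "(x, z) \<notin> E\<^sup>*" "\<not> below E V x z" for x z
  proof
    assume "T x z"
    with z x T have zx: "(z, x) \<in> E" by blast
    then have sub: "{y \<in> V. (x, y) \<in> E\<^sup>*} \<subseteq> {y \<in> V. (z, y) \<in> E\<^sup>*}"
      by (auto intro: converse_rtrancl_into_rtrancl)
    then have "rank_in E V x \<le> rank_in E V z"
      unfolding rank_in_def using V by (intro card_mono) auto
    with z have "rank_in E V x = rank_in E V z" by (auto simp: below_def)
    with sub have "{y \<in> V. (x, y) \<in> E\<^sup>*} = {y \<in> V. (z, y) \<in> E\<^sup>*}"
      unfolding rank_in_def using V by (intro card_subset_eq) auto
    with z show False by blast
  qed
  have F: "z \<notin> excluded E V (\<kappa> s a c) x1 x2" "(x1, z) \<notin> E\<^sup>*" "(x2, z) \<notin> E\<^sup>*" "z \<in> V"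
    if "z \<in> ?F" for z
    using that IX by (auto simp: undecided_def)
  have T1: "\<not> T x1 z" if "z \<in> ?F" for z
    using F[OF that] by (intro max gen) (auto simp: excluded_def)
  have T2: "x2 \<noteq> x1 \<and> \<not> T x2 z" if "z \<in> ?F" "\<kappa> s a c z \<noteq> \<kappa> s a c x1" for z
    using F[OF that(1)] that(2) by (intro conjI max gen) (auto simp: excluded_def)
  have T3: "\<kappa> s a c x2 \<noteq> \<kappa> s a c x1 \<and> \<not> T x1 x2" if "x2 \<noteq> x1"
  proof -
    have "\<not> below E V x1 x2" using gen(3) that below_linear(1,2) unfolding generators_def by blast
    with gen that show ?thesis by (intro conjI max) (auto simp: generators_def)
  qed
  \<comment> \<open>If \<open>p\<close> or \<open>q\<close> lies in the class of \<open>x1\<close>,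
    then \<open>T1\<close> for the other one suffices. Otherwise \<open>x2\<close> differs from
    \<open>x1\<close>, and of any three distinct classes some two satisfy \<open>T\<close>, so
    \<open>p\<close> and \<open>q\<close> both lie in the class of \<open>x2\<close>.\<close>
  have "\<not> T p q"
    using T1[OF pq(1)] T1[OF pq(2)] T2[OF pq(1)] T2[OF pq(2)] T3
    unfolding T_def \<kappa>_def prod.inject
    by (smt (verit))
  with not_T pq(3) show ?thesis by blast
qed

theorem sum_closed_deviation:
  fixes V :: "'a :: linorder set" and p :: "'a \<Rightarrow> nat"
  assumes V: "finite V" and adj: "\<And>x y. adj x y = adj y x"
    and E: "E = deviation V adj s a c" and \<kappa>: "\<kappa> = (\<lambda>x. (s x, a x, c x))"
    and I: "I \<noteq> {}" "I \<subseteq> V"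
  shows "(\<Sum>C | C \<subseteq> V \<and> closed_under E C \<and> I \<subseteq> C. prod p C) =
    (\<Sum>x\<in>V. \<Sum>y\<in>V. if generators E V \<kappa> x y
      then (let J = insert x (insert y I); X = excluded E V \<kappa> x y; F = undecided E V J X in
        (\<Prod>z\<in>forced_in E V J. if z \<in> X then 0 else p z) *
        (\<Prod>l\<in>leaders E F. 1 + (\<Prod>z | z \<in> F \<and> (l, z) \<in> E\<^sup>*. p z)))
      else 0)"
  unfolding sum_closed_generators[OF V I(1), where E = E and p = p and \<kappa> = \<kappa>]
proof (intro sum.cong refl if_cong)
  fix x y assume xy: "x \<in> V" "y \<in> V" "generators E V \<kappa> x y"
  let ?J = "insert x (insert y I)" and ?X = "excluded E V \<kappa> x y"
  have E_V: "E \<subseteq> V \<times> V" and X: "?X \<subseteq> V" by (auto simp: E deviation_def excluded_def)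
  have "(q, p) \<in> E" if "p \<in> undecided E V ?J ?X" "q \<in> undecided E V ?J ?X" "(p, q) \<in> E" for p q
    by (rule undecided_symmetric[OF V adj E xy(1,2) _ _ _ _ that]) (use xy(3) in \<open>auto simp: \<kappa>\<close>)
  then show "(\<Sum>C | C \<subseteq> V \<and> closed_under E C \<and> ?J \<subseteq> C \<and> C \<inter> ?X = {}. prod p C) =
    (let J = ?J; X = ?X; F = undecided E V J X in
        (\<Prod>z\<in>forced_in E V J. if z \<in> X then 0 else p z) *
        (\<Prod>l\<in>leaders E F. 1 + (\<Prod>z | z \<in> F \<and> (l, z) \<in> E\<^sup>*. p z)))"
    unfolding Let_def by (intro sum_closed_symmetric[OF V E_V _ _ refl]) (use xy I X in auto)
qed

section \<open>Signatures of homogeneous pairs\<close>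

definition homogeneous :: "nat \<Rightarrow> (nat \<Rightarrow> nat \<Rightarrow> bool) \<Rightarrow> nat set \<Rightarrow> nat set \<Rightarrow> bool" where
  "homogeneous n adj A B \<longleftrightarrow> A \<subseteq> {..<n} \<and> B \<subseteq> {..<n} \<and> A \<inter> B = {} \<and>
     (\<forall>y\<in>{..<n} - A - B. (\<forall>x\<in>A. \<forall>x'\<in>A. adj y x = adj y x') \<and> (\<forall>x\<in>B. \<forall>x'\<in>B. adj y x = adj y x'))"

definition index_pairs :: "nat \<Rightarrow> (nat \<Rightarrow> nat \<Rightarrow> bool) \<Rightarrow> (nat set \<times> nat set) set" where
  "index_pairs n adj = {(A, B). homogeneous n adj A B \<and>
     2 \<le> card ({..<n} - A - B) \<and> (2 \<le> card A \<or> 2 \<le> card B)}"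

text \<open>A homogeneous pair \<open>(A, B)\<close> with \<open>A\<close> nonempty is classified by the least elements \<open>a\<close> of \<open>A\<close>
  and \<open>c\<close> of \<open>B\<close> (\<open>c = a\<close> if \<open>B\<close> is empty), the two least elements \<open>u < u'\<close> of the rest, the least
  element \<open>z\<close> of \<open>A \<union> B\<close> other than \<open>a\<close> and \<open>c\<close>, and the least vertex \<open>v\<close> of the rest that
  distinguishes \<open>a\<close> from \<open>c\<close> (\<open>v = n\<close> if there is none). A vertex \<open>v < n\<close> determines for every
  vertex of \<open>A \<union> B\<close> the side on which it lies.\<close>

type_synonym signature = "nat \<times> nat \<times> nat \<times> nat \<times> nat \<times> nat"

text \<open>For \<open>v = n\<close> this is constantly true, a harmless default: a vertex that
  distinguishes \<open>a\<close> from \<open>c\<close> then violates \<open>rest_ok\<close> and has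
  to lie in one of the parts, and for every other vertex the two targets in \<open>arcs_of\<close>
  agree.\<close>

definition side :: "nat \<Rightarrow> (nat \<Rightarrow> nat \<Rightarrow> bool) \<Rightarrow> nat \<Rightarrow> nat \<Rightarrow> nat \<Rightarrow> bool" where
  "side n adj a v x \<longleftrightarrow> (v < n \<longrightarrow> adj v x = adj v a)"

definition movable :: "nat \<Rightarrow> nat \<Rightarrow> nat \<Rightarrow> nat \<Rightarrow> nat \<Rightarrow> nat \<Rightarrow> nat \<Rightarrow> bool" where
  "movable a c u u' z v y \<longleftrightarrow> y \<noteq> u \<and> y \<noteq> u' \<and> y \<noteq> v \<and> (z \<le> y \<or> y = a \<or> y = c)"

definition first_ok ::
    "nat \<Rightarrow> (nat \<Rightarrow> nat \<Rightarrow> bool) \<Rightarrow> nat \<Rightarrow> nat \<Rightarrow> nat \<Rightarrow> nat \<Rightarrow> nat \<Rightarrow> nat \<Rightarrow> nat \<Rightarrow> bool" where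
  "first_ok n adj a c u u' z v y \<longleftrightarrow>
     a \<le> y \<and> (y \<noteq> c \<or> c = a) \<and> movable a c u u' z v y \<and> side n adj a v y"

definition second_ok ::
    "nat \<Rightarrow> (nat \<Rightarrow> nat \<Rightarrow> bool) \<Rightarrow> nat \<Rightarrow> nat \<Rightarrow> nat \<Rightarrow> nat \<Rightarrow> nat \<Rightarrow> nat \<Rightarrow> nat \<Rightarrow> bool" where
  "second_ok n adj a c u u' z v y \<longleftrightarrow>
     c \<noteq> a \<and> c \<le> y \<and> y \<noteq> a \<and> movable a c u u' z v y \<and> (v < n \<longrightarrow> \<not> side n adj a v y)"

definition rest_ok ::
    "(nat \<Rightarrow> nat \<Rightarrow> bool) \<Rightarrow> nat \<Rightarrow> nat \<Rightarrow> nat \<Rightarrow> nat \<Rightarrow> nat \<Rightarrow> nat \<Rightarrow> nat \<Rightarrow> bool" where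
  "rest_ok adj a c u u' z v y \<longleftrightarrow>
     y \<noteq> a \<and> y \<noteq> c \<and> y \<noteq> z \<and> (y = u \<or> u' \<le> y) \<and> (adj y a \<noteq> adj y c \<longrightarrow> v \<le> y)"

definition signature_ok ::
    "nat \<Rightarrow> (nat \<Rightarrow> nat \<Rightarrow> bool) \<Rightarrow> nat \<Rightarrow> nat \<Rightarrow> nat \<Rightarrow> nat \<Rightarrow> nat \<Rightarrow> nat \<Rightarrow> bool" where
  "signature_ok n adj a c u u' z v \<longleftrightarrow>
     u < u' \<and> z \<noteq> a \<and> z \<noteq> c \<and> (v < n \<longrightarrow> adj v a \<noteq> adj v c)"

definition arcs_of :: "nat \<Rightarrow> (nat \<Rightarrow> nat \<Rightarrow> bool) \<Rightarrow> nat \<Rightarrow> nat \<Rightarrow> nat \<Rightarrow> (nat \<times> nat) set" where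
  "arcs_of n adj a c v =
     deviation {..<n} adj (side n adj a v) (\<lambda>y. adj y a) (\<lambda>y. adj y c)"

text \<open>Homogeneity and the minimality conditions of a signature are broken up into conditions
  on single vertices and one closure condition on the union, the form that can be counted.\<close>

definition classified ::
    "nat \<Rightarrow> (nat \<Rightarrow> nat \<Rightarrow> bool) \<Rightarrow> nat \<Rightarrow> nat \<Rightarrow> nat \<Rightarrow> nat \<Rightarrow> nat \<Rightarrow> nat \<Rightarrow> (nat set \<times> nat set) set" where
  "classified n adj a c u u' z v = {(A, B). A \<subseteq> {..<n} \<and> B \<subseteq> {..<n} \<and> A \<inter> B = {} \<and>
     (\<forall>y\<in>A. first_ok n adj a c u u' z v y) \<and> (\<forall>y\<in>B. second_ok n adj a c u u' z v y) \<and>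
     (\<forall>y\<in>{..<n} - A - B. rest_ok adj a c u u' z v y) \<and>
     closed_under (arcs_of n adj a c v) (A \<union> B)}"

definition has_signature ::
    "nat \<Rightarrow> (nat \<Rightarrow> nat \<Rightarrow> bool) \<Rightarrow> nat set \<Rightarrow> nat set \<Rightarrow> nat \<Rightarrow> nat \<Rightarrow> nat \<Rightarrow> nat \<Rightarrow> nat \<Rightarrow> nat \<Rightarrow> bool" where
  "has_signature n adj A B a c u u' z v \<longleftrightarrow>
     a \<in> A \<and> (\<forall>y\<in>A. a \<le> y) \<and> (if B = {} then c = a else c \<in> B \<and> (\<forall>y\<in>B. c \<le> y)) \<and>
     u \<in> {..<n} - A - B \<and> u' \<in> {..<n} - A - B \<and> u < u' \<and> (\<forall>y\<in>{..<n} - A - B. y = u \<or> u' \<le> y) \<and>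
     z \<in> A \<union> B - {a, c} \<and> (\<forall>y\<in>A \<union> B - {a, c}. z \<le> y) \<and>
     (v = n \<or> v \<in> {..<n} - A - B \<and> adj v a \<noteq> adj v c) \<and>
     (\<forall>y\<in>{..<n} - A - B. adj y a \<noteq> adj y c \<longrightarrow> v \<le> y)"

lemma classified_iff:
  assumes adj: "\<And>x y. adj x y = adj y x"
    and lt: "a < n" "c < n" "u < n" "u' < n" "z < n" "v \<le> n" and ok: "signature_ok n adj a c u u' z v"
  shows "(A, B) \<in> classified n adj a c u u' z v \<longleftrightarrow>
    homogeneous n adj A B \<and> has_signature n adj A B a c u u' z v"
proof
  assume "(A, B) \<in> classified n adj a c u u' z v"
  then have AB: "A \<subseteq> {..<n}" "B \<subseteq> {..<n}" "A \<inter> B = {}"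
    and A: "\<And>y. y \<in> A \<Longrightarrow> first_ok n adj a c u u' z v y"
    and B: "\<And>y. y \<in> B \<Longrightarrow> second_ok n adj a c u u' z v y"
    and U: "\<And>y. y < n \<Longrightarrow> y \<notin> A \<Longrightarrow> y \<notin> B \<Longrightarrow> rest_ok adj a c u u' z v y"
    and cl: "closed_under (arcs_of n adj a c v) (A \<union> B)"
    by (auto simp: classified_def)
  \<comment> \<open>Positions are encoded by exclusion: \<open>a\<close> fails both
    \<open>second_ok\<close> and \<open>rest_ok\<close>, so only \<open>A\<close> is left for it.
    The other vertices of the signature are placed in the same way.\<close>
  have in_A: "a \<in> A" using A[of a] B[of a] U[of a] lt by (auto simp: second_ok_def rest_ok_def)
  have in_B: "c \<noteq> a \<Longrightarrow> c \<in> B" using A[of c] B[of c] U[of c] lt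
    by (auto simp: first_ok_def rest_ok_def)
  have B_empty: "c = a \<Longrightarrow> B = {}" using B by (auto simp: second_ok_def)
  have in_U: "u \<notin> A \<union> B" "u' \<notin> A \<union> B" "v \<notin> A \<union> B"
    using A B by (auto simp: first_ok_def second_ok_def movable_def)
  have in_AB: "z \<in> A \<union> B" using U[of z] lt by (auto simp: rest_ok_def)
  have arc: "adj y x = (if side n adj a v x then adj y a else adj y c)"
    if "x \<in> A \<union> B" "y \<in> {..<n} - A - B" for x y
    using cl that AB adj[of x y] unfolding closed_under_def arcs_of_def deviation_def by blast
  have "adj y x = adj y a" if "x \<in> A" "y \<in> {..<n} - A - B" for x y
    using arc[of x y] A[of x] that by (simp add: first_ok_def)
  moreover have "adj y x = adj y c" if "x \<in> B" "y \<in> {..<n} - A - B" for x y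
  proof (cases "v < n")
    case True
    then have "\<not> side n adj a v x" using B[OF that(1)] by (simp add: second_ok_def)
    with arc[of x y] that show ?thesis by simp
  next
    case False
    then have "adj y a = adj y c" using U[of y] that by (auto simp: rest_ok_def)
    with arc[of x y] that show ?thesis by simp
  qed
  ultimately have "homogeneous n adj A B" using AB by (auto simp: homogeneous_def)
  moreover have "has_signature n adj A B a c u u' z v"
  proof -
    have "v = n \<or> v \<in> {..<n} - A - B \<and> adj v a \<noteq> adj v c"
      using in_U(3) lt ok by (auto simp: signature_ok_def)
    moreover have "\<forall>y\<in>{..<n} - A - B. (y = u \<or> u' \<le> y) \<and> (adj y a \<noteq> adj y c \<longrightarrow> v \<le> y)"
      using U by (auto simp: rest_ok_def)
    moreover have "\<forall>y\<in>A \<union> B - {a, c}. z \<le> y" "\<forall>y\<in>A. a \<le> y" "\<forall>y\<in>B. c \<le> y"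
      using A B by (auto simp: first_ok_def second_ok_def movable_def)
    ultimately show ?thesis
      using in_A in_B B_empty in_U in_AB lt ok by (auto simp: has_signature_def signature_ok_def)
  qed
  ultimately show "homogeneous n adj A B \<and> has_signature n adj A B a c u u' z v" ..
next
  assume "homogeneous n adj A B \<and> has_signature n adj A B a c u u' z v"
  then have h: "homogeneous n adj A B" and s: "has_signature n adj A B a c u u' z v" by auto
  have AB: "A \<subseteq> {..<n}" "B \<subseteq> {..<n}" "A \<inter> B = {}" using h by (auto simp: homogeneous_def)
  have a: "a \<in> A" and c: "B \<noteq> {} \<Longrightarrow> c \<in> B \<and> c \<noteq> a" and ca: "B = {} \<Longrightarrow> c = a"
    using s AB by (auto simp: has_signature_def split: if_splits)
  have hA: "adj y x = adj y a" if "x \<in> A" "y \<in> {..<n} - A - B" for x y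
    using h a that unfolding homogeneous_def by blast
  have hB: "adj y x = adj y c" if "x \<in> B" "y \<in> {..<n} - A - B" for x y
    using h c that unfolding homogeneous_def by blast
  have v: "v < n \<Longrightarrow> v \<in> {..<n} - A - B \<and> adj v a \<noteq> adj v c"
    using s by (auto simp: has_signature_def)
  have sA: "side n adj a v x" if "x \<in> A" for x
    using hA[OF that] v by (auto simp: side_def)
  have sB: "\<not> side n adj a v x" if "x \<in> B" "v < n" for x
    using hB[OF that(1)] v that(2) by (auto simp: side_def)
  have mov: "movable a c u u' z v y" if "y \<in> A \<union> B" for y
    using that s AB by (auto simp: movable_def has_signature_def)
  have "first_ok n adj a c u u' z v y" if "y \<in> A" for y
    using that s AB c ca mov sA by (auto simp: first_ok_def has_signature_def split: if_splits)
  moreover have "second_ok n adj a c u u' z v y" if "y \<in> B" for y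
    using that s AB c mov sB by (auto simp: second_ok_def has_signature_def split: if_splits)
  moreover have rest: "rest_ok adj a c u u' z v y" if "y \<in> {..<n} - A - B" for y
  proof -
    have "c \<in> A \<union> B" using a c ca by (cases "B = {}") auto
    with that s a show ?thesis by (auto simp: rest_ok_def has_signature_def)
  qed
  moreover have "closed_under (arcs_of n adj a c v) (A \<union> B)"
    unfolding closed_under_def
  proof (intro allI impI)
    fix x y assume xy: "(x, y) \<in> arcs_of n adj a c v" "x \<in> A \<union> B"
    then have d: "y < n" "adj y x \<noteq> (if side n adj a v x then adj y a else adj y c)"
      using adj[of x y] by (auto simp: arcs_of_def deviation_def)
    show "y \<in> A \<union> B"
    proof (rule ccontr)
      assume "y \<notin> A \<union> B"
      with d have y: "y \<in> {..<n} - A - B" by simp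
      show False
      proof (cases "x \<in> A")
        case True
        with d hA[OF _ y] sA show False by simp
      next
        case False
        with xy have x: "x \<in> B" by simp
        show False
        proof (cases "v < n")
          case True
          with sB x have "\<not> side n adj a v x" by blast
          with d(2) hB[OF x y] show False by simp
        next
          case False
          then have "adj y a = adj y c" using rest[OF y] d(1) by (auto simp: rest_ok_def)
          with d(2) hB[OF x y] show False by metis
        qed
      qed
    qed
  qed
  ultimately show "(A, B) \<in> classified n adj a c u u' z v"
    using AB by (auto simp: classified_def)
qed

lemma least_unique:
  fixes x y :: nat
  shows "x \<in> S \<Longrightarrow> \<forall>t\<in>S. x \<le> t \<Longrightarrow> y \<in> S \<Longrightarrow> \<forall>t\<in>S. y \<le> t \<Longrightarrow> x = y"
  by (meson antisym)

text \<open>Each component is the least element of a set determined by the pair and the components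
  already identified; for \<open>v\<close> this set includes the default \<open>n\<close>.\<close>

lemma has_signature_unique:
  assumes "has_signature n adj A B a c u u' z v" "has_signature n adj A B b d w w' y t"
  shows "(a, c, u, u', z, v) = (b, d, w, w', y, t)"
proof -
  let ?U = "{..<n} - A - B"
  note s = assms[unfolded has_signature_def]
  have a: "a = b" by (rule least_unique[of _ A]) (use s in simp_all)
  have c: "c = d"
  proof (cases "B = {}")
    case True
    with s a show ?thesis by simp
  next
    case False
    show ?thesis by (rule least_unique[of _ B]) (use s False in simp_all)
  qed
  have z: "z = y" by (rule least_unique[of _ "A \<union> B - {a, c}"]) (use s a c in simp_all)
  have u: "u \<in> ?U" "\<forall>x\<in>?U. u \<le> x" if "has_signature n adj A B a c u u' z v" for a c u u' z v
  proof -
    have U: "u \<in> ?U" "u < u'" "\<forall>y\<in>?U. y = u \<or> u' \<le> y"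
      using that unfolding has_signature_def by simp_all
    then show "u \<in> ?U" by simp
    show "\<forall>x\<in>?U. u \<le> x" using U(2,3) by fastforce
  qed
  have uw: "u = w" by (rule least_unique[of _ ?U]) (use u[OF assms(1)] u[OF assms(2)] in simp_all)
  have u': "u' \<in> ?U - {u}" "\<forall>x\<in>?U - {u}. u' \<le> x"
    if "has_signature n adj A B a c u u' z v" for a c u u' z v
    using that by (auto simp: has_signature_def)
  have uw': "u' = w'"
    by (rule least_unique[of _ "?U - {u}"]) (use u'[OF assms(1)] u'[OF assms(2)] uw in simp_all)
  have v: "v \<in> insert n {x \<in> ?U. adj x a \<noteq> adj x c}"
    "\<forall>x\<in>insert n {x \<in> ?U. adj x a \<noteq> adj x c}. v \<le> x"
    if "has_signature n adj A B a c u u' z v" for a c u u' z v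
    using that by (auto simp: has_signature_def)
  have "v = t"
    by (rule least_unique[of _ "insert n {x \<in> ?U. adj x a \<noteq> adj x c}"])
       (use v[OF assms(1)] v[OF assms(2)] a c in simp_all)
  with a c z uw uw' show ?thesis by simp
qed

lemma ex_Least_nat:
  assumes "(S :: nat set) \<noteq> {}"
  obtains x where "x \<in> S" "\<forall>y\<in>S. x \<le> y"
proof -
  from assms obtain y where "y \<in> S" by blast
  then show thesis by (intro that[of "LEAST x. x \<in> S"]) (auto intro: LeastI Least_le)
qed

lemma card_ge_2_remove:
  assumes "2 \<le> card S"
  obtains y where "y \<in> S" "y \<noteq> x"
proof -
  have "\<not> S \<subseteq> {x}"
  proof
    assume "S \<subseteq> {x}"
    then have "card S \<le> card {x}" by (intro card_mono) auto
    with assms show False by simp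
  qed
  with that show thesis by blast
qed

lemma ex_signature:
  assumes "(A, B) \<in> index_pairs n adj" "A \<noteq> {}"
  shows "\<exists>a c u u' z v. has_signature n adj A B a c u u' z v"
proof -
  let ?U = "{..<n} - A - B"
  have AB: "A \<subseteq> {..<n}" "B \<subseteq> {..<n}" "A \<inter> B = {}" and U: "2 \<le> card ?U"
    and W: "2 \<le> card A \<or> 2 \<le> card B"
    using assms by (auto simp: index_pairs_def homogeneous_def)
  obtain a where a: "a \<in> A" "\<forall>y\<in>A. a \<le> y" by (rule ex_Least_nat[OF assms(2)])
  obtain c where c: "if B = {} then c = a else c \<in> B \<and> (\<forall>y\<in>B. c \<le> y)"
  proof (cases "B = {}")
    case True
    with that[of a] show thesis by simp
  next
    case False
    from ex_Least_nat[OF this] that show thesis by (metis False)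
  qed
  have "?U \<noteq> {}" using U by force
  then obtain u where u: "u \<in> ?U" "\<forall>y\<in>?U. u \<le> y" by (rule ex_Least_nat)
  obtain y where "y \<in> ?U" "y \<noteq> u" by (rule card_ge_2_remove[OF U])
  then have "?U - {u} \<noteq> {}" by auto
  then obtain u' where u': "u' \<in> ?U - {u}" "\<forall>y\<in>?U - {u}. u' \<le> y" by (rule ex_Least_nat)
  \<comment> \<open>A part with two elements has one besides its own least element, and the other
    reference vertex lies in the other part or is \<open>a\<close> itself.\<close>
  have "A \<union> B - {a, c} \<noteq> {}"
    using W
  proof
    assume "2 \<le> card A"
    then obtain y where "y \<in> A" "y \<noteq> a" by (rule card_ge_2_remove)
    then show ?thesis using c AB by (auto split: if_splits)
  next
    assume "2 \<le> card B"
    then obtain y where "y \<in> B" "y \<noteq> c" by (rule card_ge_2_remove)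
    then show ?thesis using a AB by auto
  qed
  then obtain z where z: "z \<in> A \<union> B - {a, c}" "\<forall>y\<in>A \<union> B - {a, c}. z \<le> y" by (rule ex_Least_nat)
  let ?M = "{y \<in> ?U. adj y a \<noteq> adj y c}"
  obtain v where v: "v = n \<or> v \<in> ?U \<and> adj v a \<noteq> adj v c"
    "\<forall>y\<in>?U. adj y a \<noteq> adj y c \<longrightarrow> v \<le> y"
  proof (cases "?M = {}")
    case True
    then show thesis by (intro that[of n]) auto
  next
    case False
    then obtain v where "v \<in> ?M" "\<forall>y\<in>?M. v \<le> y" by (rule ex_Least_nat)
    then show thesis by (intro that[of v]) auto
  qed
  have "has_signature n adj A B a c u u' z v"
    unfolding has_signature_def
    using a c u u' z v by (intro conjI) (auto simp: order.strict_iff_order)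
  then show ?thesis by blast
qed

lemma has_signature_index_pairs:
  assumes "homogeneous n adj A B" "has_signature n adj A B a c u u' z v"
  shows "(A, B) \<in> index_pairs n adj" "A \<noteq> {}" "B = {} \<longleftrightarrow> c = a"
proof -
  have fin: "finite A" "finite B" and disj: "A \<inter> B = {}"
    using assms(1) by (auto simp: homogeneous_def intro: finite_subset)
  have two: "2 \<le> card S" if "x \<in> S" "y \<in> S" "x \<noteq> y" "finite S" for S :: "nat set" and x y
    using card_mono[of S "{x, y}"] that by simp
  have "2 \<le> card ({..<n} - A - B)"
    by (rule two[of u _ u']) (use assms(2) in \<open>auto simp: has_signature_def\<close>)
  moreover have "2 \<le> card A \<or> 2 \<le> card B"
    using two[of a A z] two[of c B z] assms(2) fin by (auto simp: has_signature_def split: if_splits)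
  ultimately show "(A, B) \<in> index_pairs n adj" using assms(1) by (simp add: index_pairs_def)
  show "A \<noteq> {}" "B = {} \<longleftrightarrow> c = a"
    using assms(2) disj by (auto simp: has_signature_def split: if_splits)
qed

lemma has_signature_bounds:
  assumes "homogeneous n adj A B" "has_signature n adj A B a c u u' z v"
  shows "a < n" "c < n" "u < n" "u' < n" "z < n" "v \<le> n" "signature_ok n adj a c u u' z v"
proof -
  note s = assms(2)[unfolded has_signature_def]
  have AB: "A \<subseteq> {..<n}" "B \<subseteq> {..<n}" using assms(1) by (simp_all add: homogeneous_def)
  have "a \<in> A" "u \<in> {..<n}" "u' \<in> {..<n}" "z \<in> A \<union> B" using s by blast+
  with AB show "a < n" "u < n" "u' < n" "z < n" by auto
  with s AB show "c < n" by (cases "B = {}") auto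
  from s show "v \<le> n" by auto
  from s have "v = n \<or> adj v a \<noteq> adj v c" "u < u'" "z \<notin> {a, c}" by blast+
  then show "signature_ok n adj a c u u' z v" by (auto simp: signature_ok_def)
qed

lemma homogeneous_commute: "homogeneous n adj A B \<Longrightarrow> homogeneous n adj B A"
  unfolding homogeneous_def by blast

lemma index_pairs_commute:
  assumes "(A, B) \<in> index_pairs n adj"
  shows "(B, A) \<in> index_pairs n adj"
proof -
  have "2 \<le> card ({..<n} - A - B)" using assms by (simp add: index_pairs_def)
  also have "{..<n} - A - B = {..<n} - B - A" by auto
  finally show ?thesis using assms homogeneous_commute by (auto simp: index_pairs_def)
qed

lemma finite_index_pairs: "finite (index_pairs n adj)"
  by (rule finite_subset[of _ "Pow {..<n} \<times> Pow {..<n}"])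
     (auto simp: index_pairs_def homogeneous_def)

text \<open>Pairs with an empty first part are counted through their mirror images, which have \<open>c = a\<close>.\<close>

lemma card_index_pairs:
  assumes adj: "\<And>x y. adj x y = adj y x"
  shows "card (index_pairs n adj) =
    (\<Sum>a<n. \<Sum>c<n. \<Sum>u<n. \<Sum>u'<n. \<Sum>z<n. \<Sum>v<Suc n. if signature_ok n adj a c u u' z v
       then (if c = a then 2 else 1) * card (classified n adj a c u u' z v) else 0)"
proof -
  let ?P = "index_pairs n adj"
  let ?A = "{p \<in> ?P. fst p \<noteq> {}}" and ?A' = "{p \<in> ?P. snd p = {}}" and ?B = "{p \<in> ?P. fst p = {}}"
  let ?N = "{..<n}"
  define T where "T = {t \<in> ?N \<times> ?N \<times> ?N \<times> ?N \<times> ?N \<times> {..<Suc n}.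
    case t of (a, c, u, u', z, v) \<Rightarrow> signature_ok n adj a c u u' z v}"
  define S where "S t = (case t of (a, c, u, u', z, v) \<Rightarrow> classified n adj a c u u' z v)"
    for t :: signature
  have finT: "finite T" unfolding T_def by auto
  have S: "p \<in> S t \<longleftrightarrow> homogeneous n adj (fst p) (snd p) \<and>
      (case t of (a, c, u, u', z, v) \<Rightarrow> has_signature n adj (fst p) (snd p) a c u u' z v)"
    if "t \<in> T" for p t
    using that classified_iff[OF adj, where n = n and A = "fst p" and B = "snd p"]
    by (auto simp: T_def S_def less_Suc_eq_le)
  have S_P: "p \<in> ?P" "fst p \<noteq> {}" "snd p = {} \<longleftrightarrow> fst (snd t) = fst t" if "t \<in> T" "p \<in> S t" for p t
  proof -
    obtain a c u u' z v where t: "t = (a, c, u, u', z, v)" by (cases t)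
    have h: "homogeneous n adj (fst p) (snd p)" "has_signature n adj (fst p) (snd p) a c u u' z v"
      using that S[OF that(1), of p] by (simp_all add: t)
    show "p \<in> ?P" "fst p \<noteq> {}" "snd p = {} \<longleftrightarrow> fst (snd t) = fst t"
      using has_signature_index_pairs[OF h] by (simp_all add: t)
  qed
  have P_S: "\<exists>t\<in>T. p \<in> S t" if "p \<in> ?P" "fst p \<noteq> {}" for p
  proof -
    have h: "homogeneous n adj (fst p) (snd p)" using that by (auto simp: index_pairs_def)
    from ex_signature[of "fst p" "snd p" n adj] that obtain a c u u' z v where
      s: "has_signature n adj (fst p) (snd p) a c u u' z v" by auto
    have "(a, c, u, u', z, v) \<in> T"
      using has_signature_bounds[OF h s] by (simp add: T_def)
    moreover from this s h have "p \<in> S (a, c, u, u', z, v)" by (simp add: S)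
    ultimately show ?thesis by blast
  qed
  have disj: "S t \<inter> S t' = {}" if "t \<in> T" "t' \<in> T" "t \<noteq> t'" for t t'
  proof (rule ccontr)
    assume "S t \<inter> S t' \<noteq> {}"
    then obtain p where p: "p \<in> S t" "p \<in> S t'" by blast
    obtain a c u u' z v where t: "t = (a, c, u, u', z, v)" by (cases t)
    obtain b d w w' y x where t': "t' = (b, d, w, w', y, x)" by (cases t')
    have "has_signature n adj (fst p) (snd p) a c u u' z v"
      "has_signature n adj (fst p) (snd p) b d w w' y x"
      using p S[OF that(1), of p] S[OF that(2), of p] by (simp_all add: t t')
    from has_signature_unique[OF this] that(3) show False by (simp add: t t')
  qed
  have fin: "finite (S t)" if "t \<in> T" for t
    by (rule finite_subset[OF _ finite_index_pairs[of n adj]]) (use S_P(1)[OF that] in auto)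
  have "?A = (\<Union>t\<in>T. S t)"
  proof (intro equalityI subsetI)
    fix p assume "p \<in> ?A"
    then show "p \<in> (\<Union>t\<in>T. S t)" using P_S[of p] by simp
  next
    fix p assume "p \<in> (\<Union>t\<in>T. S t)"
    then obtain t where t: "t \<in> T" "p \<in> S t" by blast
    from S_P(1,2)[OF t] show "p \<in> ?A" by blast
  qed
  then have A: "card ?A = (\<Sum>t\<in>T. card (S t))"
    by (simp only:) (rule card_UN_disjoint; use finT fin disj in blast)
  have "?A' = (\<Union>t\<in>{t \<in> T. fst (snd t) = fst t}. S t)"
  proof (intro equalityI subsetI)
    fix p assume p: "p \<in> ?A'"
    \<comment> \<open>With an empty second part, the cardinality condition falls on the first
      part.\<close>
    then have "fst p \<noteq> {}" by (auto simp: index_pairs_def)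
    with p obtain t where t: "t \<in> T" "p \<in> S t" using P_S[of p] by auto
    with p S_P(3)[OF t] have "t \<in> {t \<in> T. fst (snd t) = fst t}" by blast
    then show "p \<in> (\<Union>t\<in>{t \<in> T. fst (snd t) = fst t}. S t)" using t(2) by (rule UN_I)
  next
    fix p assume "p \<in> (\<Union>t\<in>{t \<in> T. fst (snd t) = fst t}. S t)"
    then obtain t where t: "t \<in> T" "p \<in> S t" "fst (snd t) = fst t" by blast
    with S_P(1,3)[OF t(1,2)] show "p \<in> ?A'" by blast
  qed
  then have "card ?A' = (\<Sum>t\<in>{t \<in> T. fst (snd t) = fst t}. card (S t))"
    by (simp only:) (rule card_UN_disjoint; use finT fin disj in auto)
  also have "\<dots> = (\<Sum>t\<in>T. if fst (snd t) = fst t then card (S t) else 0)"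
    by (rule sum.inter_filter[OF finT])
  finally have A': "card ?A' = (\<Sum>t\<in>T. if fst (snd t) = fst t then card (S t) else 0)" .
  have "bij_betw prod.swap ?A' ?B"
    by (rule bij_betw_byWitness[where f' = prod.swap]) (auto intro: index_pairs_commute)
  then have B: "card ?B = card ?A'" by (simp add: bij_betw_same_card)
  have "?P = ?A \<union> ?B" by auto
  moreover have "card (?A \<union> ?B) = card ?A + card ?B"
    by (rule card_Un_disjoint) (auto intro: finite_subset[OF _ finite_index_pairs])
  ultimately have "card ?P = card ?A + card ?B" by simp
  also have "\<dots> = (\<Sum>t\<in>T. (if fst (snd t) = fst t then 2 else 1) * card (S t))"
    unfolding A A' B sum.distrib[symmetric] by (rule sum.cong) auto
  also have "\<dots> = (\<Sum>t\<in>?N \<times> ?N \<times> ?N \<times> ?N \<times> ?N \<times> {..<Suc n}.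
    if (case t of (a, c, u, u', z, v) \<Rightarrow> signature_ok n adj a c u u' z v)
    then (if fst (snd t) = fst t then 2 else 1) * card (S t) else 0)"
    unfolding T_def by (rule sum.inter_filter) auto
  also have "\<dots> = (\<Sum>a<n. \<Sum>c<n. \<Sum>u<n. \<Sum>u'<n. \<Sum>z<n. \<Sum>v<Suc n. if signature_ok n adj a c u u' z v
       then (if c = a then 2 else 1) * card (classified n adj a c u u' z v) else 0)"
    by (simp only: sum.cartesian_product' S_def case_prod_conv fst_conv snd_conv)
  finally show ?thesis .
qed

text \<open>Once the union \<open>C\<close> is fixed, the conditions on the two parts are
  vertexwise, so the splittings of \<open>C\<close> are independent choices of a side for each
  vertex. The condition on the rest only says which vertices \<open>C\<close> must contain.\<close>

lemma card_classified:
  "card (classified n adj a c u u' z v) =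
    (\<Sum>C | C \<subseteq> {..<n} \<and> closed_under (arcs_of n adj a c v) C \<and>
        {y \<in> {..<n}. \<not> rest_ok adj a c u u' z v y} \<subseteq> C.
      \<Prod>y\<in>C. of_bool (first_ok n adj a c u u' z v y) + of_bool (second_ok n adj a c u u' z v y))"
    (is "_ = sum _ ?S")
proof -
  let ?f = "first_ok n adj a c u u' z v" and ?s = "second_ok n adj a c u u' z v"
  let ?I = "{y \<in> {..<n}. \<not> rest_ok adj a c u u' z v y}"
  let ?h = "\<lambda>C. {A. A \<subseteq> C \<and> (\<forall>y\<in>A. ?f y) \<and> (\<forall>y\<in>C - A. ?s y)}"
  have finS: "finite ?S" by (rule finite_subset[of _ "Pow {..<n}"]) auto
  have finC: "finite C" if "C \<in> ?S" for C using that by (auto intro: finite_subset)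
  have of_bool_prod: "(\<Prod>y\<in>A. of_bool (P y) :: nat) = of_bool (\<forall>y\<in>A. P y)" if "finite A" for A P
    using that by induction auto
  have inner: "(\<Prod>y\<in>C. of_bool (?f y) + of_bool (?s y)) = card (?h C)" if "C \<in> ?S" for C
  proof -
    note fin = finC[OF that]
    have "(\<Prod>y\<in>C. of_bool (?f y) + of_bool (?s y) :: nat) =
        (\<Sum>A\<in>Pow C. (\<Prod>y\<in>A. of_bool (?f y)) * (\<Prod>y\<in>C - A. of_bool (?s y)))"
      by (rule prod_add[OF fin])
    also have "\<dots> = (\<Sum>A\<in>Pow C. of_bool ((\<forall>y\<in>A. ?f y) \<and> (\<forall>y\<in>C - A. ?s y)))"
      by (rule sum.cong) (auto simp: of_bool_prod fin finite_subset[OF _ fin] of_bool_conj)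
    also have "\<dots> = card {A \<in> Pow C. (\<forall>y\<in>A. ?f y) \<and> (\<forall>y\<in>C - A. ?s y)}"
      using fin by (simp add: sum_of_bool_eq Int_def)
    finally show ?thesis by simp
  qed
  have "bij_betw (\<lambda>(A, B). (A \<union> B, A)) (classified n adj a c u u' z v) (SIGMA C : ?S. ?h C)"
    by (rule bij_betw_byWitness[where f' = "\<lambda>(C, A). (A, C - A)"]) (auto simp: classified_def Un_absorb1)
  then have "card (classified n adj a c u u' z v) = card (SIGMA C : ?S. ?h C)"
    by (rule bij_betw_same_card)
  also have "\<dots> = (\<Sum>C\<in>?S. card (?h C))"
    using finS finC by (intro card_SigmaI) (auto intro: finite_subset[OF _ finite_Pow_iff[THEN iffD2]])
  finally show ?thesis using inner by simp
qed

section \<open>Evaluating the count\<close>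

text \<open>The range checks make \<open>entry\<close> symmetric on all numbers if the matrix is
  symmetric. They also protect the row offset, which is computed by a loop of \<open>fst g\<close>
  rounds and is right only for \<open>i\<close> up to \<open>fst g\<close>.\<close>

definition entry :: "nat \<times> (nat \<Rightarrow> nat) \<Rightarrow> nat \<Rightarrow> nat \<Rightarrow> bool" where
  "entry g i j \<longleftrightarrow> i < fst g \<and> j < fst g \<and> 0 < snd g (i * fst g + j)"

lemma efficient_entry:
  assumes i: "efficient \<Gamma> i" and j: "efficient \<Gamma> j"
  shows "efficient \<Gamma> (\<lambda>x e. of_bool (entry x (i x e) (j x e)))"
proof -
  let ?row = "\<lambda>x e. rec_nat 0 (\<lambda>k s. if k < i x e then s + fst x else s) (fst x)"
  have "rec_nat 0 (\<lambda>k s. if k < l then s + n else s) m = min l m * n" for l m n :: nat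
    by (induction m) (auto simp: min_def le_Suc_eq)
  then have "entry x (i x e) (j x e) \<longleftrightarrow>
      i x e < fst x \<and> j x e < fst x \<and> 0 < snd x (?row x e + j x e)" for x e
    by (auto simp: entry_def)
  moreover have "efficient \<Gamma> ?row"
    by (rule efficient_fold) (intro efficient_intros i)+
  ultimately show ?thesis
    by (simp only:) (intro efficient_intros i j)
qed

section \<open>Vertex sets coded as numbers, and reachability\<close>

definition power_of_two :: "nat \<Rightarrow> nat \<Rightarrow> nat" where
  "power_of_two n k = rec_nat 1 (\<lambda>i t. if i < k then t + t else t) n"

lemma power_of_two: "power_of_two n k = 2 ^ min k n"
  unfolding power_of_two_def by (induction n) (auto simp: min_def le_Suc_eq)

lemma efficient_power_of_two: "efficient \<Gamma> k \<Longrightarrow> efficient \<Gamma> (\<lambda>x e. power_of_two (fst x) (k x e))"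
  unfolding power_of_two_def by (rule efficient_fold) (intro efficient_intros; assumption)+

definition has_bit :: "nat \<Rightarrow> nat \<Rightarrow> nat \<Rightarrow> bool" where
  "has_bit n s j \<longleftrightarrow> power_of_two n j \<le> rec_nat s (\<lambda>i t. if j < n - 1 - i \<and> power_of_two n (n - 1 - i) \<le> t
     then t - power_of_two n (n - 1 - i) else t) n"

text \<open>The high bits are subtracted from the top, until only the bits up to position \<open>j\<close> remain.\<close>

lemma has_bit:
  assumes "s < 2 ^ n" "j < n"
  shows "has_bit n s j \<longleftrightarrow> bit s j"
proof -
  let ?f = "\<lambda>i t. if j < n - 1 - i \<and> power_of_two n (n - 1 - i) \<le> t
     then t - power_of_two n (n - 1 - i) else t"
  have "rec_nat s ?f k = s mod 2 ^ max (Suc j) (n - k)" if "k \<le> n" for k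
    using that
  proof (induction k)
    case 0
    then show ?case using assms by (simp add: max_def)
  next
    case (Suc k)
    let ?q = "n - 1 - k"
    show ?case
    proof (cases "j < ?q")
      case True
      then have m: "max (Suc j) (n - k) = Suc ?q" "max (Suc j) (n - Suc k) = ?q" by auto
      have p: "power_of_two n ?q = 2 ^ ?q" by (simp add: power_of_two)
      have "s mod 2 ^ Suc ?q = 2 ^ ?q * of_bool (bit s ?q) + s mod 2 ^ ?q"
        using take_bit_Suc_from_most[of ?q s] unfolding take_bit_eq_mod .
      moreover have "\<not> 2 ^ ?q \<le> s mod 2 ^ ?q" by (simp add: not_le)
      ultimately show ?thesis
        using Suc True m p by (cases "bit s ?q") auto
    next
      case False
      then have "max (Suc j) (n - k) = max (Suc j) (n - Suc k)" by auto
      with False Suc show ?thesis by simp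
    qed
  qed
  from this[of n] have "has_bit n s j \<longleftrightarrow> 2 ^ j \<le> s mod 2 ^ Suc j"
    using assms(2) by (simp add: has_bit_def power_of_two)
  also have "\<dots> \<longleftrightarrow> bit s j"
  proof -
    have e: "s mod 2 ^ Suc j = 2 ^ j * of_bool (bit s j) + s mod 2 ^ j"
      using take_bit_Suc_from_most[of j s] unfolding take_bit_eq_mod .
    have "\<not> 2 ^ j \<le> s mod 2 ^ j" by (simp add: not_le)
    then show ?thesis unfolding e by (cases "bit s j") simp_all
  qed
  finally show ?thesis .
qed

lemma efficient_has_bit:
  assumes "efficient \<Gamma> s" "efficient \<Gamma> j"
  shows "efficient \<Gamma> (\<lambda>x e. of_bool (has_bit (fst x) (s x e) (j x e)))"
proof -
  let ?f = "\<lambda>x e i t. if j x e < fst x - 1 - i \<and> power_of_two (fst x) (fst x - 1 - i) \<le> t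
     then t - power_of_two (fst x) (fst x - 1 - i) else t"
  have "efficient \<Gamma> (\<lambda>x e. rec_nat (s x e) (?f x e) (fst x))"
    by (rule efficient_fold) (intro efficient_intros efficient_power_of_two assms)+
  then show ?thesis
    unfolding has_bit_def by (intro efficient_le efficient_power_of_two assms)
qed

text \<open>A loop carries a single number, so the set of vertices reached so far is stored in its
  binary digits.\<close>

definition reach_code :: "nat \<Rightarrow> (nat \<Rightarrow> nat \<Rightarrow> bool) \<Rightarrow> nat \<Rightarrow> nat" where
  "reach_code n Q x = rec_nat (power_of_two n x)
     (\<lambda>k s. \<Sum>i<n. if has_bit n s i \<or> (\<exists>j<n. has_bit n s j \<and> Q j i) then power_of_two n i else 0) n"

definition set_code :: "nat \<Rightarrow> nat set \<Rightarrow> nat" where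
  "set_code n S = (\<Sum>i<n. if i \<in> S then 2 ^ i else 0)"

lemma set_code_less: "set_code n S < 2 ^ n"
  unfolding set_code_def by (induction n) auto

lemma bit_set_code: "bit (set_code n S) j \<longleftrightarrow> j < n \<and> j \<in> S"
proof -
  have "set_code n S = (\<Sum>i<n. of_bool (map (\<lambda>i. i \<in> S) [0..<n] ! i) * 2 ^ i)"
    unfolding set_code_def by (rule sum.cong) auto
  also have "\<dots> = horner_sum of_bool 2 (map (\<lambda>i. i \<in> S) [0..<n])"
    by (simp add: horner_sum_eq_sum atLeast0LessThan)
  finally show ?thesis by (auto simp: bit_simps)
qed

lemma has_bit_set_code: "j < n \<Longrightarrow> has_bit n (set_code n S) j \<longleftrightarrow> j \<in> S"
  by (simp add: has_bit set_code_less bit_set_code)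

text \<open>A set of vertices that is not yet closed gains an element in every round, so \<open>n\<close> rounds suffice.\<close>

lemma has_bit_reach_code:
  assumes "x < n" "y < n" and E: "E \<subseteq> {..<n} \<times> {..<n}"
    and Q: "\<And>i j. i < n \<Longrightarrow> j < n \<Longrightarrow> Q i j \<longleftrightarrow> (i, j) \<in> E"
  shows "has_bit n (reach_code n Q x) y \<longleftrightarrow> (x, y) \<in> E\<^sup>*"
proof -
  define S where "S = rec_nat {x} (\<lambda>k S. S \<union> E `` S)"
  have S_simps: "S 0 = {x}" "\<And>k. S (Suc k) = S k \<union> E `` S k" by (simp_all add: S_def)
  have S_n: "S k \<subseteq> {..<n}" for k
    using assms(1) E by (induction k) (auto simp: S_simps)
  let ?f = "\<lambda>k s. \<Sum>i<n. if has_bit n s i \<or> (\<exists>j<n. has_bit n s j \<and> Q j i) then power_of_two n i else 0"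
  have "rec_nat (power_of_two n x) ?f k = set_code n (S k)" for k
  proof (induction k)
    case 0
    have "set_code n {x} = (\<Sum>i<n. if i = x then 2 ^ x else 0)"
      unfolding set_code_def by (rule sum.cong) auto
    then show ?case using assms(1) by (simp add: S_simps power_of_two)
  next
    case (Suc k)
    have "set_code n (S (Suc k)) = ?f k (set_code n (S k))"
      unfolding set_code_def[of n "S (Suc k)"]
    proof (rule sum.cong[OF refl], rule if_cong)
      fix i assume i: "i \<in> {..<n}"
      then have "(\<exists>j<n. has_bit n (set_code n (S k)) j \<and> Q j i) \<longleftrightarrow> (\<exists>j<n. j \<in> S k \<and> (j, i) \<in> E)"
        by (simp add: has_bit_set_code Q cong: conj_cong)
      also have "\<dots> \<longleftrightarrow> i \<in> E `` S k" using S_n[of k] by auto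
      finally show "(i \<in> S (Suc k)) = (has_bit n (set_code n (S k)) i \<or>
          (\<exists>j<n. has_bit n (set_code n (S k)) j \<and> Q j i))"
        using i by (simp add: S_simps has_bit_set_code)
    qed (simp_all add: power_of_two)
    with Suc show ?case by simp
  qed
  then have code: "reach_code n Q x = set_code n (S n)" by (simp add: reach_code_def)
  have fin: "finite (S k)" for k using S_n finite_subset by blast
  have "E `` S k \<subseteq> S k \<or> Suc k \<le> card (S k)" for k
  proof (induction k)
    case 0
    then show ?case by (simp add: S_simps)
  next
    case (Suc k)
    show ?case
    proof (cases "E `` S k \<subseteq> S k")
      case True
      then have "S (Suc k) = S k" by (auto simp: S_simps)
      with True show ?thesis by simp
    next
      case False
      then have "S k \<subset> S (Suc k)" by (auto simp: S_simps)
      from psubset_card_mono[OF fin this] Suc False show ?thesis by simp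
    qed
  qed
  moreover have "card (S n) \<le> n" using card_mono[OF _ S_n[of n]] by simp
  ultimately have closed: "E `` S n \<subseteq> S n" by (meson Suc_n_not_le_n le_trans)
  have mono: "x \<in> S k" for k by (induction k) (auto simp: S_simps)
  have "(x, z) \<in> E\<^sup>*" if "z \<in> S k" for z k
    using that by (induction k arbitrary: z) (auto simp: S_simps intro: rtrancl_into_rtrancl)
  moreover have "z \<in> S n" if "(x, z) \<in> E\<^sup>*" for z
    using that closed mono by (induction rule: rtrancl_induct) auto
  ultimately show ?thesis using assms(2) by (auto simp: code has_bit_set_code)
qed

context
  fixes n :: nat and adj :: "nat \<Rightarrow> nat \<Rightarrow> bool" and a c v :: nat
begin

text \<open>This and the following definitions restate the notions of the closed set count with all
  quantifiers bounded by \<open>n\<close>, so that loops can evaluate them.\<close>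

definition linked :: "nat \<Rightarrow> nat \<Rightarrow> bool" where
  "linked x y \<longleftrightarrow> x < n \<and> y < n \<and> (x, y) \<in> (arcs_of n adj a c v)\<^sup>*"

lemma linked_code:
  "linked x y \<longleftrightarrow> x < n \<and> y < n \<and> has_bit n (reach_code n
     (\<lambda>i j. adj i j \<noteq> (if side n adj a v i then adj j a else adj j c)) x) y"
  unfolding linked_def
  by (intro conj_cong refl, rule has_bit_reach_code[symmetric]) (auto simp: arcs_of_def deviation_def)

definition rank_of :: "nat \<Rightarrow> nat" where
  "rank_of x = (\<Sum>y<n. of_bool (linked x y))"

definition lower :: "nat \<Rightarrow> nat \<Rightarrow> bool" where
  "lower x y \<longleftrightarrow> rank_of x < rank_of y \<or> rank_of x = rank_of y \<and> x < y"

definition same_class :: "nat \<Rightarrow> nat \<Rightarrow> bool" where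
  "same_class x y \<longleftrightarrow> (side n adj a v x = side n adj a v y) \<and>
     (adj x a = adj y a) \<and> (adj x c = adj y c)"

definition is_gen :: "nat \<Rightarrow> nat \<Rightarrow> bool" where
  "is_gen x y \<longleftrightarrow> y = x \<or> \<not> same_class y x \<and> \<not> linked x y \<and> lower y x"

definition excl :: "nat \<Rightarrow> nat \<Rightarrow> nat \<Rightarrow> bool" where
  "excl x y z \<longleftrightarrow> lower x z \<or> \<not> same_class z x \<and> \<not> linked x z \<and> (y = x \<or> lower y z)"

context
  fixes u u' z :: nat
begin

definition forced :: "nat \<Rightarrow> nat \<Rightarrow> nat \<Rightarrow> bool" where
  "forced x y t \<longleftrightarrow> (\<exists>w<n. (w = x \<or> w = y \<or> \<not> rest_ok adj a c u u' z v w) \<and> linked w t)"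

definition free :: "nat \<Rightarrow> nat \<Rightarrow> nat \<Rightarrow> bool" where
  "free x y t \<longleftrightarrow> \<not> forced x y t \<and> \<not> (\<exists>w<n. excl x y w \<and> linked t w)"

definition leader :: "nat \<Rightarrow> nat \<Rightarrow> nat \<Rightarrow> bool" where
  "leader x y l \<longleftrightarrow> free x y l \<and> (\<forall>t<n. free x y t \<and> linked l t \<longrightarrow> l \<le> t)"

definition scale :: "nat \<Rightarrow> nat \<Rightarrow> nat" where
  "scale t s = (if first_ok n adj a c u u' z v t then s else 0) +
     (if second_ok n adj a c u u' z v t then s else 0)"

text \<open>Both products are accumulated in one pass over the vertices. Starting the inner loop at
  \<open>s\<close> multiplies the product over a component by \<open>s\<close>, and
  \<open>scale\<close> multiplies by at most two through additions.\<close>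

definition weight :: "nat \<Rightarrow> nat \<Rightarrow> nat" where
  "weight x y = rec_nat 1 (\<lambda>i s. if forced x y i then if excl x y i then 0 else scale i s
     else if leader x y i then s + rec_nat s (\<lambda>j t. if free x y j \<and> linked i j then scale j t else t) n
     else s) n"

definition class_count :: nat where
  "class_count = (\<Sum>x<n. \<Sum>y<n. if is_gen x y then weight x y else 0)"

lemma scale: "scale t s =
    (of_bool (first_ok n adj a c u u' z v t) + of_bool (second_ok n adj a c u u' z v t)) * s"
  by (simp add: scale_def)

theorem class_count:
  assumes adj: "\<And>x y. adj x y = adj y x" and a: "a < n"
  shows "class_count = card (classified n adj a c u u' z v)"
proof -
  let ?V = "{..<n}" and ?E = "arcs_of n adj a c v"
  let ?I = "{y \<in> {..<n}. \<not> rest_ok adj a c u u' z v y}"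
  let ?\<kappa> = "\<lambda>x. (side n adj a v x, adj x a, adj x c)"
  define p :: "nat \<Rightarrow> nat" where "p y = of_bool (first_ok n adj a c u u' z v y) +
    of_bool (second_ok n adj a c u u' z v y)" for y
  have linked: "linked x y \<longleftrightarrow> (x, y) \<in> ?E\<^sup>*" if "x < n" "y < n" for x y
    using that by (simp add: linked_def)
  have rank: "rank_of x = rank_in ?E ?V x" if "x < n" for x
  proof -
    have "rank_of x = card ({..<n} \<inter> {y. linked x y})" by (simp add: rank_of_def sum_of_bool_eq)
    also have "{..<n} \<inter> {y. linked x y} = {y \<in> ?V. (x, y) \<in> ?E\<^sup>*}" using that by (auto simp: linked)
    finally show ?thesis by (simp add: rank_in_def)
  qed
  have lower: "lower x y \<longleftrightarrow> below ?E ?V x y" if "x < n" "y < n" for x y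
    using that by (simp add: lower_def below_def rank)
  have same: "same_class x y \<longleftrightarrow> ?\<kappa> x = ?\<kappa> y" for x y by (auto simp: same_class_def)
  have gen: "is_gen x y \<longleftrightarrow> generators ?E ?V ?\<kappa> x y" if "x < n" "y < n" for x y
    using that by (simp add: is_gen_def generators_def linked lower same)
  have excl: "t \<in> excluded ?E ?V ?\<kappa> x y \<longleftrightarrow> excl x y t" if "x < n" "y < n" "t < n" for x y t
    using that by (simp add: excl_def excluded_def linked lower same)
  have w: "weight x y = (let J = insert x (insert y ?I); X = excluded ?E ?V ?\<kappa> x y; F = undecided ?E ?V J X in
        (\<Prod>z\<in>forced_in ?E ?V J. if z \<in> X then 0 else p z) *
        (\<Prod>l\<in>leaders ?E F. 1 + (\<Prod>z | z \<in> F \<and> (l, z) \<in> ?E\<^sup>*. p z)))"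
    if x: "x < n" and y: "y < n" for x y
  proof -
    let ?J = "insert x (insert y ?I)" and ?X = "excluded ?E ?V ?\<kappa> x y"
    let ?F = "undecided ?E ?V ?J ?X"
    have forced: "t \<in> forced_in ?E ?V ?J \<longleftrightarrow> t < n \<and> forced x y t" for t
      using x y by (auto simp: forced_in_def forced_def linked_def)
    have "?X \<subseteq> ?V" by (auto simp: excluded_def)
    then have "(\<exists>w\<in>?X. (t, w) \<in> ?E\<^sup>*) \<longleftrightarrow> (\<exists>w<n. excl x y w \<and> linked t w)" if "t < n" for t
      using that excl[OF x y] by (auto simp: linked_def)
    then have free: "t \<in> ?F \<longleftrightarrow> t < n \<and> free x y t" for t
      using forced[of t] by (auto simp: undecided_def forced_in_def free_def)
    have leader: "l \<in> leaders ?E ?F \<longleftrightarrow> l < n \<and> leader x y l" for l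
      using free by (auto simp: leaders_def leader_def linked_def)
    have inner: "rec_nat s (\<lambda>j t. if free x y j \<and> linked i j then scale j t else t) k =
        s * (\<Prod>j<k. if free x y j \<and> linked i j then p j else 1)" for i s k
      by (induction k) (auto simp: scale p_def)
    have comp: "(\<Prod>j<n. if free x y j \<and> linked i j then p j else 1) =
        (\<Prod>z | z \<in> ?F \<and> (i, z) \<in> ?E\<^sup>*. p z)" if "i < n" for i
    proof -
      have "{z. z \<in> ?F \<and> (i, z) \<in> ?E\<^sup>*} = {z \<in> {..<n}. free x y z \<and> linked i z}"
        using free that by (auto simp: linked_def)
      then show ?thesis by (simp only: prod.inter_filter[OF finite_lessThan])
    qed
    let ?h = "\<lambda>i. if forced x y i then if excl x y i then 0 else p i
      else if leader x y i then 1 + (\<Prod>z | z \<in> ?F \<and> (i, z) \<in> ?E\<^sup>*. p z) else 1"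
    have "rec_nat 1 (\<lambda>i s. if forced x y i then if excl x y i then 0 else scale i s
       else if leader x y i then s + rec_nat s (\<lambda>j t. if free x y j \<and> linked i j then scale j t else t) n
       else s) k = (\<Prod>i<k. ?h i)" if "k \<le> n" for k
      using that
    proof (induction k)
      case (Suc k)
      then show ?case using inner comp[of k] by (simp add: scale p_def algebra_simps)
    qed simp
    from this[of n] have "weight x y = (\<Prod>i<n. ?h i)" by (simp add: weight_def)
    also have "\<dots> = (\<Prod>i<n. (if i \<in> forced_in ?E ?V ?J then if i \<in> ?X then 0 else p i else 1) *
        (if i \<in> leaders ?E ?F then 1 + (\<Prod>z | z \<in> ?F \<and> (i, z) \<in> ?E\<^sup>*. p z) else 1))"
    proof (intro prod.cong refl)
      fix i assume i: "i \<in> {..<n}"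
      have "leader x y i \<Longrightarrow> \<not> forced x y i" by (simp add: leader_def free_def)
      then show "?h i = (if i \<in> forced_in ?E ?V ?J then if i \<in> ?X then 0 else p i else 1) *
          (if i \<in> leaders ?E ?F then 1 + (\<Prod>z | z \<in> ?F \<and> (i, z) \<in> ?E\<^sup>*. p z) else 1)"
        using i excl[OF x y, of i] unfolding forced leader by auto
    qed
    also have "\<dots> = (\<Prod>z\<in>forced_in ?E ?V ?J. if z \<in> ?X then 0 else p z) *
        (\<Prod>l\<in>leaders ?E ?F. 1 + (\<Prod>z | z \<in> ?F \<and> (l, z) \<in> ?E\<^sup>*. p z))"
    proof -
      have sub: "{i \<in> {..<n}. i \<in> forced_in ?E ?V ?J} = forced_in ?E ?V ?J"
        "{i \<in> {..<n}. i \<in> leaders ?E ?F} = leaders ?E ?F"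
        using forced leader by auto
      show ?thesis
        unfolding prod.distrib prod.inter_filter[OF finite_lessThan, symmetric] sub ..
    qed
    finally show ?thesis by (simp add: Let_def)
  qed
  \<comment> \<open>This supplies the nonempty set of required vertices without which generators
    need not exist.\<close>
  have "a \<in> ?I" using a by (simp add: rest_ok_def)
  then have "card (classified n adj a c u u' z v) =
    (\<Sum>x<n. \<Sum>y<n. if generators ?E ?V ?\<kappa> x y
      then (let J = insert x (insert y ?I); X = excluded ?E ?V ?\<kappa> x y; F = undecided ?E ?V J X in
        (\<Prod>z\<in>forced_in ?E ?V J. if z \<in> X then 0 else p z) *
        (\<Prod>l\<in>leaders ?E F. 1 + (\<Prod>z | z \<in> F \<and> (l, z) \<in> ?E\<^sup>*. p z)))
      else 0)"
    unfolding card_classified p_def[symmetric]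
    by (intro sum_closed_deviation[where adj = adj] finite_lessThan adj refl) (auto simp: arcs_of_def)
  also have "\<dots> = class_count"
    unfolding class_count_def
    by (intro sum.cong refl if_cong) (simp_all only: gen w lessThan_iff)
  finally show ?thesis by simp
qed

end

end

section \<open>Efficiency of the counting expression\<close>

lemma efficient_sum_Suc:
  assumes "efficient (push \<Gamma>) (\<lambda>x p. F x (fst p) (snd (snd p)))" "efficient \<Gamma> (\<lambda>x e. F x e (fst x))"
  shows "efficient \<Gamma> (\<lambda>x e. \<Sum>i<Suc (fst x). F x e i)"
  \<comment> \<open>Loops have \<open>n\<close> rounds, so the last summand, the case
    \<open>v = n\<close> in \<open>pair_count\<close>, is added separately.\<close>
  using efficient_add[OF efficient_sum[where F = F, OF assms(1)] assms(2)] by simp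

lemma efficient_side:
  assumes "efficient \<Gamma> a" "efficient \<Gamma> v" "efficient \<Gamma> y"
  shows "efficient \<Gamma> (\<lambda>x e. of_bool (side (fst x) (entry x) (a x e) (v x e) (y x e)))"
  unfolding side_def by (intro efficient_intros efficient_entry assms)

lemma efficient_linked:
  assumes "efficient \<Gamma> a" "efficient \<Gamma> c" "efficient \<Gamma> v" "efficient \<Gamma> y" "efficient \<Gamma> z"
  shows "efficient \<Gamma> (\<lambda>x e. of_bool (linked (fst x) (entry x) (a x e) (c x e) (v x e) (y x e) (z x e)))"
proof -
  have "efficient \<Gamma> (\<lambda>x e. reach_code (fst x)
     (\<lambda>i j. entry x i j \<noteq> (if side (fst x) (entry x) (a x e) (v x e) i
       then entry x j (a x e) else entry x j (c x e))) (y x e))"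
    unfolding reach_code_def
    by (rule efficient_fold) (intro efficient_intros efficient_entry efficient_side efficient_has_bit efficient_power_of_two assms)+
  then show ?thesis
    unfolding linked_code by (intro efficient_intros efficient_has_bit assms)
qed

lemma efficient_lower:
  assumes "efficient \<Gamma> a" "efficient \<Gamma> c" "efficient \<Gamma> v" "efficient \<Gamma> y" "efficient \<Gamma> z"
  shows "efficient \<Gamma> (\<lambda>x e. of_bool (lower (fst x) (entry x) (a x e) (c x e) (v x e) (y x e) (z x e)))"
  unfolding lower_def rank_of_def by (intro efficient_intros efficient_linked assms)

lemma efficient_same_class:
  assumes "efficient \<Gamma> a" "efficient \<Gamma> c" "efficient \<Gamma> v" "efficient \<Gamma> y" "efficient \<Gamma> z"
  shows "efficient \<Gamma> (\<lambda>x e. of_bool (same_class (fst x) (entry x) (a x e) (c x e) (v x e) (y x e) (z x e)))"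
  unfolding same_class_def by (intro efficient_intros efficient_side efficient_entry assms)

lemma efficient_is_gen:
  assumes "efficient \<Gamma> a" "efficient \<Gamma> c" "efficient \<Gamma> v" "efficient \<Gamma> y" "efficient \<Gamma> z"
  shows "efficient \<Gamma> (\<lambda>x e. of_bool (is_gen (fst x) (entry x) (a x e) (c x e) (v x e) (y x e) (z x e)))"
  unfolding is_gen_def by (intro efficient_intros efficient_linked efficient_lower efficient_same_class assms)

lemma efficient_excl:
  assumes "efficient \<Gamma> a" "efficient \<Gamma> c" "efficient \<Gamma> v" "efficient \<Gamma> y" "efficient \<Gamma> z" "efficient \<Gamma> t"
  shows "efficient \<Gamma> (\<lambda>x e. of_bool (excl (fst x) (entry x) (a x e) (c x e) (v x e) (y x e) (z x e) (t x e)))"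
  unfolding excl_def by (intro efficient_intros efficient_linked efficient_lower efficient_same_class assms)

context
  fixes \<Gamma> :: "'e fn list" and a c v u u' z :: "'e fn"
  assumes sig: "efficient \<Gamma> a" "efficient \<Gamma> c" "efficient \<Gamma> v" "efficient \<Gamma> u" "efficient \<Gamma> u'" "efficient \<Gamma> z"
begin

lemma efficient_first_ok:
  assumes "efficient \<Gamma> y"
  shows "efficient \<Gamma> (\<lambda>x e. of_bool (first_ok (fst x) (entry x) (a x e) (c x e) (u x e) (u' x e) (z x e)
    (v x e) (y x e)))"
  unfolding first_ok_def movable_def by (intro efficient_intros efficient_side sig assms)

lemma efficient_second_ok:
  assumes "efficient \<Gamma> y"
  shows "efficient \<Gamma> (\<lambda>x e. of_bool (second_ok (fst x) (entry x) (a x e) (c x e) (u x e) (u' x e) (z x e)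
    (v x e) (y x e)))"
  unfolding second_ok_def movable_def by (intro efficient_intros efficient_side sig assms)

lemma efficient_rest_ok:
  assumes "efficient \<Gamma> y"
  shows "efficient \<Gamma> (\<lambda>x e. of_bool (rest_ok (entry x) (a x e) (c x e) (u x e) (u' x e) (z x e)
    (v x e) (y x e)))"
  unfolding rest_ok_def by (intro efficient_intros efficient_entry sig assms)

lemma efficient_signature_ok:
  "efficient \<Gamma> (\<lambda>x e. of_bool (signature_ok (fst x) (entry x) (a x e) (c x e) (u x e) (u' x e) (z x e) (v x e)))"
  unfolding signature_ok_def by (intro efficient_intros efficient_entry sig)

lemma efficient_scale:
  assumes "efficient \<Gamma> t" "efficient \<Gamma> s"
  shows "efficient \<Gamma> (\<lambda>x e. scale (fst x) (entry x) (a x e) (c x e) (v x e) (u x e) (u' x e) (z x e) (t x e) (s x e))"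
  unfolding scale_def by (intro efficient_intros efficient_first_ok efficient_second_ok assms)

end

lemma efficient_forced:
  assumes "efficient \<Gamma> a" "efficient \<Gamma> c" "efficient \<Gamma> v" "efficient \<Gamma> u" "efficient \<Gamma> u'" "efficient \<Gamma> z" "efficient \<Gamma> y" "efficient \<Gamma> y'" "efficient \<Gamma> t"
  shows "efficient \<Gamma> (\<lambda>x e. of_bool (forced (fst x) (entry x) (a x e) (c x e) (v x e) (u x e) (u' x e) (z x e)
    (y x e) (y' x e) (t x e)))"
  unfolding forced_def by (intro efficient_intros efficient_linked efficient_rest_ok assms)

lemma efficient_free:
  assumes "efficient \<Gamma> a" "efficient \<Gamma> c" "efficient \<Gamma> v" "efficient \<Gamma> u" "efficient \<Gamma> u'" "efficient \<Gamma> z" "efficient \<Gamma> y" "efficient \<Gamma> y'" "efficient \<Gamma> t"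
  shows "efficient \<Gamma> (\<lambda>x e. of_bool (free (fst x) (entry x) (a x e) (c x e) (v x e) (u x e) (u' x e) (z x e)
    (y x e) (y' x e) (t x e)))"
  unfolding free_def by (intro efficient_intros efficient_linked efficient_excl efficient_forced assms)

lemma efficient_leader:
  assumes "efficient \<Gamma> a" "efficient \<Gamma> c" "efficient \<Gamma> v" "efficient \<Gamma> u" "efficient \<Gamma> u'" "efficient \<Gamma> z" "efficient \<Gamma> y" "efficient \<Gamma> y'" "efficient \<Gamma> t"
  shows "efficient \<Gamma> (\<lambda>x e. of_bool (leader (fst x) (entry x) (a x e) (c x e) (v x e) (u x e) (u' x e) (z x e)
    (y x e) (y' x e) (t x e)))"
  unfolding leader_def by (intro efficient_intros efficient_linked efficient_free assms)

lemma efficient_class_count: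
  assumes "efficient \<Gamma> a" "efficient \<Gamma> c" "efficient \<Gamma> v" "efficient \<Gamma> u" "efficient \<Gamma> u'" "efficient \<Gamma> z"
  shows "efficient \<Gamma> (\<lambda>x e. class_count (fst x) (entry x) (a x e) (c x e) (v x e) (u x e) (u' x e) (z x e))"
  unfolding class_count_def weight_def
  by (intro efficient_intros efficient_fold efficient_is_gen efficient_forced efficient_excl efficient_scale efficient_leader efficient_free efficient_linked assms)

definition pair_count :: "nat \<times> (nat \<Rightarrow> nat) \<Rightarrow> nat" where
  "pair_count x = (\<Sum>a<fst x. \<Sum>c<fst x. \<Sum>u<fst x. \<Sum>u'<fst x. \<Sum>z<fst x. \<Sum>v<Suc (fst x).
     if signature_ok (fst x) (entry x) a c u u' z v
     then (let k = class_count (fst x) (entry x) a c v u u' z in if c = a then k + k else k) else 0)"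

lemma efficient_pair_count: "efficient [] (\<lambda>x (e :: unit). pair_count x)"
  unfolding pair_count_def Let_def
  by (intro efficient_intros efficient_sum_Suc efficient_signature_ok efficient_class_count)

lemma pair_count:
  assumes "\<And>i j. entry (n, m) i j = entry (n, m) j i"
  shows "pair_count (n, m) = card (index_pairs n (entry (n, m)))"
  unfolding card_index_pairs[OF assms] pair_count_def fst_conv Let_def
  by (intro sum.cong refl if_cong) (use class_count assms in auto)

section \<open>Transfer from graphs to adjacency matrices\<close>

lemma card_homogeneous_pairs_index:
  assumes bij: "bij_betw f {..<n} (pverts G)"
    and adj: "\<And>i j. i < n \<Longrightarrow> j < n \<Longrightarrow> adj i j \<longleftrightarrow> (f i, f j) \<in> parcs G"
  shows "card (homogeneous_pairs G) = card (index_pairs n adj)"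
proof -
  let ?F = "\<lambda>(A, B). (f ` ({..<n} - A - B), f ` A, f ` B)"
  have inj: "inj_on f {..<n}" and im: "f ` {..<n} = pverts G"
    using bij by (auto simp: bij_betw_def)
  have V: "{..<n} - A - B \<subseteq> {..<n}" for A B by auto
  have img_U: "f ` ({..<n} - A - B) = pverts G - f ` A - f ` B" if "A \<subseteq> {..<n}" "B \<subseteq> {..<n}" for A B
    using inj_on_image_set_diff[OF inj, of "{..<n} - A" B] inj_on_image_set_diff[OF inj, of "{..<n}" A]
      that im by auto
  have card: "card (f ` A) = card A" if "A \<subseteq> {..<n}" for A
    using that inj by (meson card_image inj_on_subset)
  have aon: "all_or_none_adjacent G (f y) (f ` A) \<longleftrightarrow> (\<forall>x\<in>A. \<forall>x'\<in>A. adj y x = adj y x')"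
    if "y < n" "A \<subseteq> {..<n}" for y A
  proof -
    have "all_or_none_adjacent G (f y) (f ` A) \<longleftrightarrow> (\<forall>x\<in>A. adj y x) \<or> (\<forall>x\<in>A. \<not> adj y x)"
      using that adj by (auto simp: all_or_none_adjacent_def)
    then show ?thesis by blast
  qed
  have iff: "homogeneous_pair G (f ` ({..<n} - A - B)) (f ` A) (f ` B) \<longleftrightarrow> (A, B) \<in> index_pairs n adj"
    if AB: "A \<subseteq> {..<n}" "B \<subseteq> {..<n}" for A B
  proof -
    have i1: "f ` A \<inter> f ` B = {} \<longleftrightarrow> A \<inter> B = {}"
      using inj_on_image_Int[OF inj AB] by auto
    have i2: "f ` ({..<n} - A - B) \<union> f ` A \<union> f ` B = pverts G"
      using AB im by (auto simp: img_U)
    have i3: "f ` ({..<n} - A - B) \<inter> f ` A = {}" "f ` ({..<n} - A - B) \<inter> f ` B = {}"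
      unfolding img_U[OF AB] by blast+
    have "homogeneous_pair G (f ` ({..<n} - A - B)) (f ` A) (f ` B) \<longleftrightarrow>
        A \<inter> B = {} \<and> 2 \<le> card ({..<n} - A - B) \<and> (2 \<le> card A \<or> 2 \<le> card B) \<and>
        (\<forall>y\<in>{..<n} - A - B. all_or_none_adjacent G (f y) (f ` A)) \<and>
        (\<forall>y\<in>{..<n} - A - B. all_or_none_adjacent G (f y) (f ` B))"
      by (simp only: homogeneous_pair_def i1 i2 i3 card[OF V] card[OF AB(1)] card[OF AB(2)]
          ball_simps simp_thms)
    also have "\<dots> \<longleftrightarrow> (A, B) \<in> index_pairs n adj"
    proof -
      have "(\<forall>y\<in>{..<n} - A - B. all_or_none_adjacent G (f y) (f ` C)) \<longleftrightarrow>
          (\<forall>y\<in>{..<n} - A - B. \<forall>x\<in>C. \<forall>x'\<in>C. adj y x = adj y x')" if "C \<subseteq> {..<n}" for C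
        by (rule ball_cong[OF refl], rule aon) (use that in auto)
      note eq = this[OF AB(1)] this[OF AB(2)]
      show ?thesis
        unfolding index_pairs_def homogeneous_def mem_Collect_eq case_prod_conv ball_conj_distrib eq
        by (simp only: AB simp_thms conj_ac)
    qed
    finally show ?thesis .
  qed
  have "inj_on ?F (index_pairs n adj)"
  proof (rule inj_onI)
    fix p q assume pq: "p \<in> index_pairs n adj" "q \<in> index_pairs n adj" "?F p = ?F q"
    obtain A B A' B' where e: "p = (A, B)" "q = (A', B')" by (cases p, cases q) blast
    have "A \<subseteq> {..<n}" "B \<subseteq> {..<n}" "A' \<subseteq> {..<n}" "B' \<subseteq> {..<n}" "f ` A = f ` A'" "f ` B = f ` B'"
      using pq by (auto simp: e index_pairs_def homogeneous_def)
    with inj_on_image_eq_iff[OF inj] show "p = q" by (simp add: e)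
  qed
  moreover have "?F ` index_pairs n adj = homogeneous_pairs G"
  proof (intro equalityI subsetI)
    fix t assume "t \<in> ?F ` index_pairs n adj"
    then obtain A B where AB: "(A, B) \<in> index_pairs n adj" "t = ?F (A, B)" by auto
    then have "A \<subseteq> {..<n}" "B \<subseteq> {..<n}" by (auto simp: index_pairs_def homogeneous_def)
    with AB iff show "t \<in> homogeneous_pairs G" by (simp add: homogeneous_pairs_def)
  next
    fix t assume t: "t \<in> homogeneous_pairs G"
    obtain U W1 W2 where e: "t = (U, W1, W2)" by (cases t)
    from t e have h: "homogeneous_pair G U W1 W2" by (simp add: homogeneous_pairs_def)
    then have W: "W1 \<subseteq> f ` {..<n}" "W2 \<subseteq> f ` {..<n}" and U: "U = pverts G - W1 - W2"
      unfolding im homogeneous_pair_def by blast+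
    obtain A where A: "A \<subseteq> {..<n}" "W1 = f ` A" using W(1) by (meson subset_imageE)
    obtain B where B: "B \<subseteq> {..<n}" "W2 = f ` B" using W(2) by (meson subset_imageE)
    have U': "U = f ` ({..<n} - A - B)" using U A B img_U by simp
    have "(A, B) \<in> index_pairs n adj" using h iff[OF A(1) B(1)] A(2) B(2) U' by simp
    moreover have "t = ?F (A, B)" using e A(2) B(2) U' by simp
    ultimately show "t \<in> ?F ` index_pairs n adj" by blast
  qed
  ultimately have "bij_betw ?F (index_pairs n adj) (homogeneous_pairs G)" by (rule bij_betw_imageI)
  then show ?thesis by (rule bij_betw_same_card[symmetric])
qed

lemma adjacency_word_props:
  fixes G :: "'a :: linorder pair_pre_digraph"
  defines "n \<equiv> card (pverts G)" and "vs \<equiv> sorted_list_of_set (pverts G)"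
  assumes fin: "finite (pverts G)"
  shows "length (adjacency_word G) = n * n"
    and "i < n \<Longrightarrow> j < n \<Longrightarrow> adjacency_word G ! (i * n + j) \<longleftrightarrow> (vs ! i, vs ! j) \<in> parcs G"
proof -
  have len: "length vs = n" using fin by (simp add: vs_def n_def)
  have concat: "length (concat (map (\<lambda>u. map (\<lambda>v. P u v) ys) xs)) = length xs * length ys \<and>
      (\<forall>i<length xs. \<forall>j<length ys.
        concat (map (\<lambda>u. map (\<lambda>v. P u v) ys) xs) ! (i * length ys + j) = P (xs ! i) (ys ! j))"
    for P :: "'a \<Rightarrow> 'a \<Rightarrow> bool" and xs ys
  proof (induction xs)
    case (Cons x xs)
    have "(map (P x) ys @ concat (map (\<lambda>u. map (P u) ys) xs)) ! (i * length ys + j) = P ((x # xs) ! i) (ys ! j)"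
      if "i < Suc (length xs)" "j < length ys" for i j
      using that Cons by (cases i) (simp_all add: nth_append)
    with Cons show ?case by simp
  qed simp
  have "adjacency_word G = concat (map (\<lambda>u. map (\<lambda>v. (u, v) \<in> parcs G) vs) vs)"
    by (simp add: adjacency_word_def vs_def Let_def)
  with concat[of "\<lambda>u v. (u, v) \<in> parcs G" vs vs] len
  show "length (adjacency_word G) = n * n"
    "i < n \<Longrightarrow> j < n \<Longrightarrow> adjacency_word G ! (i * n + j) \<longleftrightarrow> (vs ! i, vs ! j) \<in> parcs G"
    by auto
qed

lemma card_homogeneous_pairs:
  fixes G :: "'a :: linorder pair_pre_digraph"
  assumes "pair_graph G"
  shows "card (homogeneous_pairs G) = pair_count (card (pverts G), matrix_memory (adjacency_word G))"
proof -
  interpret pair_graph G by fact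
  let ?n = "card (pverts G)" and ?vs = "sorted_list_of_set (pverts G)"
  let ?adj = "entry (?n, matrix_memory (adjacency_word G))"
  have fin: "finite (pverts G)" by (rule finite_verts[simplified with_proj_simps])
  have lt: "i * ?n + j < ?n * ?n" if "i < ?n" "j < ?n" for i j
  proof -
    have "i * ?n + j < Suc i * ?n" using that by simp
    also have "\<dots> \<le> ?n * ?n" using that by (intro mult_le_mono1) simp
    finally show ?thesis .
  qed
  have adj: "?adj i j \<longleftrightarrow> i < ?n \<and> j < ?n \<and> (?vs ! i, ?vs ! j) \<in> parcs G" for i j
    using adjacency_word_props[OF fin] lt[of i j] by (auto simp: entry_def matrix_memory_def)
  have sym: "(x, y) \<in> parcs G \<longleftrightarrow> (y, x) \<in> parcs G" for x y
    using sym_arcs by (auto simp: symmetric_def sym_def arcs_ends_def arc_to_ends_def)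
  have "bij_betw ((!) ?vs) {..<?n} (pverts G)"
    using bij_betw_nth[of ?vs "{..<?n}" "pverts G"] fin by simp
  then have "card (homogeneous_pairs G) = card (index_pairs ?n ?adj)"
    by (rule card_homogeneous_pairs_index) (simp add: adj)
  also have "\<dots> = pair_count (?n, matrix_memory (adjacency_word G))"
    by (rule pair_count[symmetric]) (use adj sym in blast)
  finally show ?thesis .
qed

theorem corollary30:
  shows "poly_time_computable {G :: nat pair_pre_digraph. pair_graph G} adjacency_word
           (\<lambda>G. card (homogeneous_pairs G))"
proof (rule poly_time_computableI[OF efficient_pair_count, where dim = "\<lambda>G. card (pverts G)"])
  fix G :: "nat pair_pre_digraph" assume "G \<in> {G. pair_graph G}"
  then interpret pair_graph G by simp
  have fin: "finite (pverts G)" by (rule finite_verts[simplified with_proj_simps])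
  show "length (adjacency_word G) = card (pverts G) * card (pverts G)"
    by (rule adjacency_word_props(1)[OF fin])
  \<comment> \<open>For the graph without vertices the sum in \<open>pair_count\<close> is empty,
    which agrees with the answer \<open>0\<close> of the program on the empty word.\<close>
  show "card (homogeneous_pairs G) = (if card (pverts G) = 0 then 0
      else pair_count (card (pverts G), matrix_memory (adjacency_word G)))"
    using card_homogeneous_pairs[OF pair_graph_axioms] by (simp add: pair_count_def)
qed

end
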